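(* Let $\mu_0,\mu_1\in\mathcal M_+$. Suppose that for $i=1,2$ there are $(\mu^i_t,V^i_t,h^i_t)_{t\in[0,1]}\in\mathcal{CE}_p(\mu_0,\mu_1;[0,1])$ such that: (1) both minimize the action: $\mathfrak E^{a,b}_{\rm Quad}((\mu^1_t,V^1_t,h^1_t)_{t\in[0,1]})=\mathfrak E^{a,b}_{\rm Quad}((\mu^2_t,V^2_t,h^2_t)_{t\in[0,1]})=\mathcal W^{a,b}_p(\mu_0,\mu_1)^2$; (2) the fluxes are antisymmetric: $V^i_t(x,y)=-V^i_t(y,x)$ for $i=1,2$, all $x,y\in\mathcal X$ and a.e. $t$; (3) if $K(x,y)=0$ then $V^i_t(x,y)=0$ for $i=1,2$; (4) $\mu^1_t(x)>0$ for every $x\in\mathcal X$ and all $t\in[0,1]$. Then the two minimizers coincide: $\mu^1_t=\mu^2_t$ for all $t\in[0,1]$, and $V^1_t=V^2_t$, $h^1_t=h^2_t$ for a.e. $t\in[0,1]$.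
   Context: Setting. $\mathcal X$ is a finite set, $K:\mathcal X\times\mathcal X\to[0,\infty)$ an irreducible Markov kernel ($\sum_y K(x,y)=1$) with unique invariant probability $\varpi$ ($\varpi(x)=\sum_y\varpi(y)K(y,x)$, $\sum_y\varpi(y)=1$), assumed reversible: $K(x,y)\varpi(x)=K(y,x)\varpi(y)$. $\mathcal M$ is the set of $\mu:\mathcal X\to[0,\infty)$ and $\mathcal M_+$ the set of $\mu:\mathcal X\to(0,\infty)$. Fix $a,b>0$ and $p\in\mathcal M_+$ with $\sum_x p(x)\varpi(x)=1$. Notation. $(\nabla\cdot\Psi)(x)=\frac12\sum_y(\Psi(x,y)-\Psi(y,x))K(x,y)$ for $\Psi\in\mathbb R^{\mathcal X\times\mathcal X}$. Logarithmic mean: $\theta(u,v)=\int_0^1u^\xi v^{1-\xi}\,d\xi$ for $u,v\ge0$, i.e. $\theta(u,u)=u$, $\theta(u,v)=\frac{u-v}{\log u-\log v}$ for $u\ne v$ positive, and $\theta(u,v)=0$ if $u=0$ or $v=0$. $\hat\mu(x,y)=\theta(\mu(x),\mu(y))$. Metric. $\mathcal W^{a,b}_p(\mu_0,\mu_1)^2$ is the infimum of $a^2\int_0^1h_t^2\,dt+b^2\int_0^1\frac12\sum_{x,y}(\psi_t(y)-\psi_t(x))^2\hat\mu_t(x,y)K(x,y)\varpi(x)\,dt$ over all triples $(\mu_t,\psi_t,h_t)_{t\in[0,1]}$ with $t\mapsto\mu_t\in\mathcal M$ absolutely continuous on $[0,1]$ with the given endpoints $\mu_0,\mu_1$, $\psi:[0,1]\to\mathbb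 R^{\mathcal X}$ and $h:[0,1]\to\mathbb R$ measurable, and $\dot\mu_t(x)+\sum_y(\psi_t(y)-\psi_t(x))\hat\mu_t(x,y)K(x,y)=h_tp(x)$ for a.e. $t$ and all $x$. Flux formulation. $\mathcal{CE}_p(\mu_0,\mu_1;[0,1])$ is the set of triples $(\mu_t,V_t,h_t)_{t\in[0,1]}$ with $t\mapsto\mu_t\in\mathcal M$ absolutely continuous with endpoints $\mu_0$ (at $t=0$) and $\mu_1$ (at $t=1$), $V:[0,1]\to\mathbb R^{\mathcal X\times\mathcal X}$ and $h:[0,1]\to\mathbb R$ measurable, and $\dot\mu_t+\nabla\cdot V_t=h_tp$ for a.e. $t$. Let $\alpha(v,s,t)=v^2/\theta(s,t)$ for $v\in\mathbb R$, $s,t\ge0$, with $v^2/0=0$ if $v=0$ and $v^2/0=+\infty$ if $v\neq0$; $A'(\mu,V)=\frac12\sum_{x,y}\alpha(V(x,y),\mu(x),\mu(y))K(x,y)\varpi(x)$ (with $0\cdot\infty=0$); and $\mathfrak E^{a,b}_{\rm Quad}((\mu_t,V_t,h_t)_{t\in[0,1]})=a^2\int_0^1|h_t|^2dt+b^2\int_0^1A'(\mu_t,V_t)\,dt\in[0,\infty]$. *)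

theory Defs
  imports "HOL-Analysis.Analysis"
begin

section \<open>Reversible Markov kernels on a finite set\<close>

definition markov_kernel :: "('x::finite \<Rightarrow> 'x \<Rightarrow> real) \<Rightarrow> bool" where
  "markov_kernel K \<longleftrightarrow> (\<forall>x y. 0 \<le> K x y) \<and> (\<forall>x. (\<Sum>y\<in>UNIV. K x y) = 1)"

primrec kernel_power :: "('x::finite \<Rightarrow> 'x \<Rightarrow> real) \<Rightarrow> nat \<Rightarrow> 'x \<Rightarrow> 'x \<Rightarrow> real" where
  "kernel_power K 0 = (\<lambda>x y. if x = y then 1 else 0)"
| "kernel_power K (Suc n) = (\<lambda>x y. \<Sum>z\<in>UNIV. K x z * kernel_power K n z y)"

definition irreducible_kernel :: "('x::finite \<Rightarrow> 'x \<Rightarrow> real) \<Rightarrow> bool" where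
  "irreducible_kernel K \<longleftrightarrow> (\<forall>x y. \<exists>n. 0 < kernel_power K n x y)"

definition invariant_prob :: "('x::finite \<Rightarrow> 'x \<Rightarrow> real) \<Rightarrow> ('x \<Rightarrow> real) \<Rightarrow> bool" where
  "invariant_prob K w \<longleftrightarrow> (\<forall>x. 0 \<le> w x) \<and> (\<Sum>y\<in>UNIV. w y) = 1 \<and>
     (\<forall>x. w x = (\<Sum>y\<in>UNIV. w y * K y x))"

definition reversible_wrt :: "('x::finite \<Rightarrow> 'x \<Rightarrow> real) \<Rightarrow> ('x \<Rightarrow> real) \<Rightarrow> bool" where
  "reversible_wrt K w \<longleftrightarrow> (\<forall>x y. K x y * w x = K y x * w y)"

section \<open>Logarithmic mean\<close>

text \<open>For \<open>u, v \<ge> 0\<close>. Since \<open>0 powr \<xi> = 0\<close> even for \<open>\<xi> = 0\<close>, the integrand differs from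
  the usual one (with \<open>0\<^sup>0 = 1\<close>) in at most the two endpoints.\<close>

definition log_mean :: "real \<Rightarrow> real \<Rightarrow> real" where
  "log_mean u v = integral {0..1} (\<lambda>\<xi>. u powr \<xi> * v powr (1 - \<xi>))"

lemma log_mean_same: "0 \<le> u \<Longrightarrow> log_mean u u = u"
  by (cases "u = 0") (simp_all add: log_mean_def flip: powr_add)

lemma log_mean_zero: "log_mean 0 v = 0" "log_mean u 0 = 0"
  by (simp_all add: log_mean_def)

lemma log_mean_neq:
  assumes "0 < u" "0 < v" "u \<noteq> v"
  shows "log_mean u v = (u - v) / (ln u - ln v)"
proof -
  define c where "c = ln u - ln v"
  have c: "c \<noteq> 0" using assms by (simp add: c_def)
  define F where "F = (\<lambda>\<xi>. u powr \<xi> * v powr (1 - \<xi>) / c)"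
  have *: "u powr \<xi> * v powr (1 - \<xi>) = exp (\<xi> * ln u + (1 - \<xi>) * ln v)" for \<xi>
    using assms by (simp add: powr_def exp_add)
  have "((\<lambda>\<xi>. u powr \<xi> * v powr (1 - \<xi>)) has_integral (F 1 - F 0)) {0..1}"
  proof (rule fundamental_theorem_of_calculus)
    fix \<xi> :: real
    have "(F has_real_derivative u powr \<xi> * v powr (1 - \<xi>)) (at \<xi> within {0..1})"
      unfolding F_def * using c
      by (auto intro!: derivative_eq_intros simp: c_def)
    then show "(F has_vector_derivative u powr \<xi> * v powr (1 - \<xi>)) (at \<xi> within {0..1})"
      by (simp add: has_real_derivative_iff_has_vector_derivative)
  qed simp
  moreover have "F 1 - F 0 = (u - v) / c"
    using assms by (simp add: F_def diff_divide_distrib)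
  ultimately show ?thesis
    by (simp add: log_mean_def c_def integral_unique)
qed

section \<open>Absolutely continuous curves\<close>

definition abs_continuous_on_Icc :: "real \<Rightarrow> real \<Rightarrow> (real \<Rightarrow> real) \<Rightarrow> bool" where
  "abs_continuous_on_Icc c d f \<longleftrightarrow>
     (\<forall>\<epsilon>>0. \<exists>\<delta>>0. \<forall>(n::nat) l r.
        (\<forall>i<n. c \<le> l i \<and> l i \<le> r i \<and> r i \<le> d) \<and>
        (\<forall>i<n. \<forall>j<n. i \<noteq> j \<longrightarrow> {l i<..<r i} \<inter> {l j<..<r j} = {}) \<and>
        (\<Sum>i<n. r i - l i) < \<delta> \<longrightarrow> (\<Sum>i<n. \<bar>f (r i) - f (l i)\<bar>) < \<epsilon>)"

definition admissible_curve ::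
    "('x::finite \<Rightarrow> real) \<Rightarrow> ('x \<Rightarrow> real) \<Rightarrow> (real \<Rightarrow> 'x \<Rightarrow> real) \<Rightarrow> bool" where
  "admissible_curve \<mu>0 \<mu>1 \<mu> \<longleftrightarrow>
     (\<forall>t\<in>{0..1}. \<forall>x. 0 \<le> \<mu> t x) \<and>
     (\<forall>x. abs_continuous_on_Icc 0 1 (\<lambda>t. \<mu> t x)) \<and>
     \<mu> 0 = \<mu>0 \<and> \<mu> 1 = \<mu>1"

section \<open>The transport distance\<close>

definition potential_triples ::
    "('x::finite \<Rightarrow> 'x \<Rightarrow> real) \<Rightarrow> ('x \<Rightarrow> real) \<Rightarrow> ('x \<Rightarrow> real) \<Rightarrow> ('x \<Rightarrow> real) \<Rightarrow>
     ((real \<Rightarrow> 'x \<Rightarrow> real) \<times> (real \<Rightarrow> 'x \<Rightarrow> real) \<times> (real \<Rightarrow> real)) set" where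
  "potential_triples K p \<mu>0 \<mu>1 = {(\<mu>, \<psi>, h).
     admissible_curve \<mu>0 \<mu>1 \<mu> \<and>
     (\<forall>x. (\<lambda>t. \<psi> t x) \<in> borel_measurable (lebesgue_on {0..1})) \<and>
     h \<in> borel_measurable (lebesgue_on {0..1}) \<and>
     (AE t in lebesgue_on {0..1}. \<forall>x. \<exists>d.
        ((\<lambda>s. \<mu> s x) has_real_derivative d) (at t within {0..1}) \<and>
        d + (\<Sum>y\<in>UNIV. (\<psi> t y - \<psi> t x) * log_mean (\<mu> t x) (\<mu> t y) * K x y) = h t * p x)}"

definition potential_action ::
    "('x::finite \<Rightarrow> 'x \<Rightarrow> real) \<Rightarrow> ('x \<Rightarrow> real) \<Rightarrow> real \<Rightarrow> real \<Rightarrow>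
     (real \<Rightarrow> 'x \<Rightarrow> real) \<times> (real \<Rightarrow> 'x \<Rightarrow> real) \<times> (real \<Rightarrow> real) \<Rightarrow> ennreal" where
  "potential_action K w a b = (\<lambda>(\<mu>, \<psi>, h).
     ennreal (a\<^sup>2) * (\<integral>\<^sup>+t. ennreal ((h t)\<^sup>2) \<partial>lebesgue_on {0..1}) +
     ennreal (b\<^sup>2) * (\<integral>\<^sup>+t. ennreal (1/2 * (\<Sum>x\<in>UNIV. \<Sum>y\<in>UNIV.
        (\<psi> t y - \<psi> t x)\<^sup>2 * log_mean (\<mu> t x) (\<mu> t y) * K x y * w x)) \<partial>lebesgue_on {0..1}))"

definition W_squared ::
    "('x::finite \<Rightarrow> 'x \<Rightarrow> real) \<Rightarrow> ('x \<Rightarrow> real) \<Rightarrow> ('x \<Rightarrow> real) \<Rightarrow> real \<Rightarrow> real \<Rightarrow>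
     ('x \<Rightarrow> real) \<Rightarrow> ('x \<Rightarrow> real) \<Rightarrow> ennreal" where
  "W_squared K w p a b \<mu>0 \<mu>1 = (INF c\<in>potential_triples K p \<mu>0 \<mu>1. potential_action K w a b c)"

section \<open>Flux formulation\<close>

definition divergence ::
    "('x::finite \<Rightarrow> 'x \<Rightarrow> real) \<Rightarrow> ('x \<Rightarrow> 'x \<Rightarrow> real) \<Rightarrow> 'x \<Rightarrow> real" where
  "divergence K \<Psi> x = 1/2 * (\<Sum>y\<in>UNIV. (\<Psi> x y - \<Psi> y x) * K x y)"

definition CE ::
    "('x::finite \<Rightarrow> 'x \<Rightarrow> real) \<Rightarrow> ('x \<Rightarrow> real) \<Rightarrow> ('x \<Rightarrow> real) \<Rightarrow> ('x \<Rightarrow> real) \<Rightarrow>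
     ((real \<Rightarrow> 'x \<Rightarrow> real) \<times> (real \<Rightarrow> 'x \<Rightarrow> 'x \<Rightarrow> real) \<times> (real \<Rightarrow> real)) set" where
  "CE K p \<mu>0 \<mu>1 = {(\<mu>, V, h).
     admissible_curve \<mu>0 \<mu>1 \<mu> \<and>
     (\<forall>x y. (\<lambda>t. V t x y) \<in> borel_measurable (lebesgue_on {0..1})) \<and>
     h \<in> borel_measurable (lebesgue_on {0..1}) \<and>
     (AE t in lebesgue_on {0..1}. \<forall>x. \<exists>d.
        ((\<lambda>s. \<mu> s x) has_real_derivative d) (at t within {0..1}) \<and>
        d + divergence K (V t) x = h t * p x)}"

definition flux_cost :: "real \<Rightarrow> real \<Rightarrow> real \<Rightarrow> ennreal" where
  "flux_cost v s t =
     (if log_mean s t = 0 then (if v = 0 then 0 else \<infinity>) else ennreal (v\<^sup>2 / log_mean s t))"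

text \<open>The convention \<open>0 * \<infinity> = 0\<close> is that of \<^typ>\<open>ennreal\<close>.\<close>

definition flux_action ::
    "('x::finite \<Rightarrow> 'x \<Rightarrow> real) \<Rightarrow> ('x \<Rightarrow> real) \<Rightarrow> ('x \<Rightarrow> real) \<Rightarrow> ('x \<Rightarrow> 'x \<Rightarrow> real) \<Rightarrow> ennreal" where
  "flux_action K w \<mu> V = ennreal (1/2) * (\<Sum>x\<in>UNIV. \<Sum>y\<in>UNIV.
     flux_cost (V x y) (\<mu> x) (\<mu> y) * ennreal (K x y * w x))"

definition E_Quad ::
    "('x::finite \<Rightarrow> 'x \<Rightarrow> real) \<Rightarrow> ('x \<Rightarrow> real) \<Rightarrow> real \<Rightarrow> real \<Rightarrow>
     (real \<Rightarrow> 'x \<Rightarrow> real) \<times> (real \<Rightarrow> 'x \<Rightarrow> 'x \<Rightarrow> real) \<times> (real \<Rightarrow> real) \<Rightarrow> ennreal" where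
  "E_Quad K w a b = (\<lambda>(\<mu>, V, h).
     ennreal (a\<^sup>2) * (\<integral>\<^sup>+t. ennreal (\<bar>h t\<bar>\<^sup>2) \<partial>lebesgue_on {0..1}) +
     ennreal (b\<^sup>2) * (\<integral>\<^sup>+t. flux_action K w (\<mu> t) (V t) \<partial>lebesgue_on {0..1}))"

end

theory Submission
  imports Defs
begin

text \<open>
  The set of curves with given endpoints that solve the continuity equation is convex, so the
  midpoint of two minimizers is a competitor, and the action is jointly convex in
  \<^term>\<open>\<mu>\<close>, \<^term>\<open>V\<close>, \<^term>\<open>h\<close>. Three facts turn this into uniqueness.

  First, the midpoint has action at least \<^const>\<open>W_squared\<close>. That infimum runs over gradient
  fluxes only, and the midpoint flux need not be a gradient. But the midpoint density is positive,
  so at each time the weighted graph Laplacian can be inverted (irreducibility makes its kernel the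
  constants) to give a gradient flux with the same divergence; it is the orthogonal projection of
  the flux in the weighted norm of the action and therefore no more expensive. Cramer's rule makes
  the potential a rational expression in the data, hence measurable in time. This is
  \<open>W_squared_le_E_Quad\<close>. Since the infimum is finite (\<open>W_squared_finite\<close>), convexity of the
  integrand must be an equality at almost every time.

  Second, the equality case. The term in \<^term>\<open>h\<close> is strictly convex, so the two \<^term>\<open>h\<close>
  agree. The flux cost \<open>v\<^sup>2 / \<theta>(s, t)\<close> is positively 1-homogeneous, hence not strictly convex;
  equality says only that along each edge the triples \<open>(v, s, t)\<close> of the two minimizers are
  proportional or both fluxes vanish (\<open>flux_cost_superadditive\<close>). The reason is that the geometric means
  \<open>s\<^sup>\<xi> t\<^sup>1\<^sup>-\<^sup>\<xi>\<close>, whose average over \<open>\<xi>\<close> is the logarithmic mean, are superadditive with equality only on rays.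

  Third, proportionality already forces equality. With \<open>r = \<mu>' / \<mu>\<close>, which is defined because
  the first curve stays positive, the edges at \<^term>\<open>x\<close> give
  \<open>V'(x, y) = r(x) V(x, y)\<close>, so \<open>div V' = r div V\<close>, and the two continuity equations combine
  to \<open>r' = (h p / \<mu>) (1 - r)\<close>. This linear equation starts from \<open>r = 1\<close>, and its coefficient
  is integrable, so \<open>r = 1\<close> throughout by a Gronwall argument for absolutely continuous functions
  (\<open>curves_eq_if_fluxes_parallel\<close>).
\<close>

section \<open>The logarithmic mean and the cost of a flux\<close>

text \<open>If an argument vanishes the integrand is identically zero, since \<open>0 powr \<xi> = 0\<close> also at the endpoints.\<close>

lemma log_mean_integrand_continuous:
  fixes u v :: real
  assumes "0 \<le> u" "0 \<le> v"
  shows "continuous_on {0..1} (\<lambda>\<xi>. u powr \<xi> * v powr (1 - \<xi>))"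
proof (cases "u = 0 \<or> v = 0")
  case False
  then show ?thesis by (auto intro!: continuous_intros)
qed auto

lemma log_mean_ge:
  assumes "0 \<le> m" "m \<le> u" "m \<le> v"
  shows "m \<le> log_mean u v"
proof -
  have "integral {0..1} (\<lambda>\<xi>. m powr \<xi> * m powr (1 - \<xi>)) \<le> log_mean u v"
    unfolding log_mean_def
    by (intro integral_le integrable_continuous_real log_mean_integrand_continuous mult_mono powr_mono2)
       (use assms in auto)
  then show ?thesis using log_mean_same[of m] assms by (simp add: log_mean_def)
qed

lemma log_mean_nonneg: "0 \<le> u \<Longrightarrow> 0 \<le> v \<Longrightarrow> 0 \<le> log_mean u v"
  using log_mean_ge[of 0 u v] by simp

lemma log_mean_pos: "0 < u \<Longrightarrow> 0 < v \<Longrightarrow> 0 < log_mean u v"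
  using log_mean_ge[of "min u v" u v] by auto

lemma log_mean_commute: "0 \<le> u \<Longrightarrow> 0 \<le> v \<Longrightarrow> log_mean u v = log_mean v u"
  by (cases "u = 0 \<or> v = 0 \<or> u = v")
     (auto simp: log_mean_zero log_mean_neq minus_divide_divide[of "u - v", symmetric] simp del: minus_divide_divide)

lemma log_mean_scale:
  assumes "0 \<le> c" "0 \<le> u" "0 \<le> v"
  shows "log_mean (c * u) (c * v) = c * log_mean u v"
proof (cases "c = 0")
  case False
  have "(c * u) powr \<xi> * (c * v) powr (1 - \<xi>) = c * (u powr \<xi> * v powr (1 - \<xi>))" for \<xi>
  proof -
    have "c powr \<xi> * c powr (1 - \<xi>) = c" using False assms by (simp flip: powr_add)
    then show ?thesis using assms by (simp add: powr_mult mult.assoc mult.left_commute)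
  qed
  then show ?thesis by (simp add: log_mean_def)
qed (simp add: log_mean_zero)

lemma geometric_mean_le_arith:
  fixes x y \<xi> :: real
  assumes "0 \<le> x" "0 \<le> y" "0 \<le> \<xi>" "\<xi> \<le> 1"
  shows "x powr \<xi> * y powr (1 - \<xi>) \<le> \<xi> * x + (1 - \<xi>) * y"
  using assms Youngs_inequality_0[of \<xi> "1 - \<xi>" x y]
  by (cases "x = 0 \<or> y = 0") auto

text \<open>Normalise by the sums \<open>\<sigma>\<close> and \<open>\<tau>\<close>, bound each normalised geometric mean by the
  weighted arithmetic mean, and add: the arithmetic means of the fractions sum to 1.\<close>

lemma geometric_mean_superadditive:
  fixes s1 t1 s2 t2 \<xi> :: real
  assumes "0 < s1" "0 < t1" "0 \<le> s2" "0 \<le> t2" "0 \<le> \<xi>" "\<xi> \<le> 1"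
  shows "s1 powr \<xi> * t1 powr (1 - \<xi>) + s2 powr \<xi> * t2 powr (1 - \<xi>)
    \<le> (s1 + s2) powr \<xi> * (t1 + t2) powr (1 - \<xi>)"
proof -
  define \<sigma> \<tau> where "\<sigma> = s1 + s2" and "\<tau> = t1 + t2"
  have pos: "\<sigma> > 0" "\<tau> > 0" using assms by (auto simp: \<sigma>_def \<tau>_def)
  define M where "M = \<sigma> powr \<xi> * \<tau> powr (1 - \<xi>)"
  have M: "M > 0" using pos by (simp add: M_def)
  have *: "s powr \<xi> * t powr (1 - \<xi>) \<le> M * (\<xi> * (s / \<sigma>) + (1 - \<xi>) * (t / \<tau>))"
    if "0 \<le> s" "0 \<le> t" for s t
  proof -
    have "s powr \<xi> * t powr (1 - \<xi>) = M * ((s / \<sigma>) powr \<xi> * (t / \<tau>) powr (1 - \<xi>))"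
      using that pos by (simp add: M_def powr_divide)
    also have "\<dots> \<le> M * (\<xi> * (s / \<sigma>) + (1 - \<xi>) * (t / \<tau>))"
      using that pos M assms by (intro mult_left_mono geometric_mean_le_arith) auto
    finally show ?thesis .
  qed
  have "s1 powr \<xi> * t1 powr (1 - \<xi>) + s2 powr \<xi> * t2 powr (1 - \<xi>)
    \<le> M * (\<xi> * ((s1 + s2) / \<sigma>) + (1 - \<xi>) * ((t1 + t2) / \<tau>))"
    using *[of s1 t1] *[of s2 t2] assms by (simp add: add_divide_distrib distrib_left)
  also have "\<dots> = M" using pos by (simp add: \<sigma>_def[symmetric] \<tau>_def[symmetric])
  finally show ?thesis by (simp add: M_def \<sigma>_def \<tau>_def)
qed

lemma log_mean_superadditive:
  assumes "0 < s1" "0 < t1" "0 \<le> s2" "0 \<le> t2"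
  shows "log_mean s1 t1 + log_mean s2 t2 \<le> log_mean (s1 + s2) (t1 + t2)"
proof -
  have "log_mean s1 t1 + log_mean s2 t2
      = integral {0..1} (\<lambda>\<xi>. s1 powr \<xi> * t1 powr (1 - \<xi>) + s2 powr \<xi> * t2 powr (1 - \<xi>))"
    unfolding log_mean_def
    by (intro integral_add[symmetric] integrable_continuous_real log_mean_integrand_continuous)
       (use assms in auto)
  also have "\<dots> \<le> log_mean (s1 + s2) (t1 + t2)"
    unfolding log_mean_def
    by (intro integral_le integrable_continuous_real continuous_on_add log_mean_integrand_continuous
          geometric_mean_superadditive) (use assms in auto)
  finally show ?thesis .
qed

text \<open>The gap in superadditivity of the integrands is continuous and nonnegative, so if its integral
  vanishes it vanishes at \<open>\<xi> = 1/2\<close>. There it is the gap in the Cauchy-Schwarz inequality for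
  \<open>(\<surd>s1, \<surd>s2)\<close> and \<open>(\<surd>t1, \<surd>t2)\<close>.\<close>

lemma log_mean_additive_imp_parallel:
  assumes pos: "0 < s1" "0 < t1" "0 \<le> s2" "0 \<le> t2"
    and eq: "log_mean (s1 + s2) (t1 + t2) = log_mean s1 t1 + log_mean s2 t2"
  shows "s1 * t2 = s2 * t1"
proof -
  define G where "G s t \<xi> = s powr \<xi> * t powr (1 - \<xi>)" for s t \<xi> :: real
  have cont: "continuous_on {0..1} (G s t)" if "0 \<le> s" "0 \<le> t" for s t
    unfolding G_def using that by (rule log_mean_integrand_continuous)
  have int: "(G s t has_integral log_mean s t) {0..1}" if "0 \<le> s" "0 \<le> t" for s t
    using integrable_integral[OF integrable_continuous_real[OF cont[OF that]]]
    by (simp add: log_mean_def G_def[abs_def])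
  define D where "D \<xi> = G (s1 + s2) (t1 + t2) \<xi> - (G s1 t1 \<xi> + G s2 t2 \<xi>)" for \<xi>
  have "(D has_integral 0) {0..1}"
    using has_integral_diff[OF int[of "s1 + s2" "t1 + t2"] has_integral_add[OF int[of s1 t1] int[of s2 t2]]]
      pos eq by (simp add: D_def[abs_def])
  moreover have "continuous_on {0..1} D"
    unfolding D_def[abs_def] using pos by (intro continuous_intros cont) auto
  moreover have "0 \<le> D \<xi>" if "\<xi> \<in> {0<..<1}" for \<xi>
    using geometric_mean_superadditive[OF pos, of \<xi>] that by (simp add: D_def G_def)
  ultimately have "D (1/2) = 0"
    using has_integral_0_cbox_imp_0[of 0 1 D "1/2"] by simp
  then have h: "sqrt ((s1 + s2) * (t1 + t2)) = sqrt (s1 * t1) + sqrt (s2 * t2)"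
    using pos by (simp add: D_def G_def powr_half_sqrt real_sqrt_mult)
  have "(s1 + s2) * (t1 + t2) = (sqrt (s1 * t1) + sqrt (s2 * t2))\<^sup>2"
    using pos by (simp flip: h)
  also have "\<dots> = s1 * t1 + s2 * t2 + 2 * (sqrt (s1 * t1) * sqrt (s2 * t2))"
    using pos by (simp add: power2_sum)
  also have "sqrt (s1 * t1) * sqrt (s2 * t2) = sqrt (s1 * t2) * sqrt (s2 * t1)"
    by (simp add: real_sqrt_mult)
  finally have "(sqrt (s1 * t2) - sqrt (s2 * t1))\<^sup>2 = 0"
    using pos by (simp add: power2_diff algebra_simps)
  then show ?thesis by simp
qed

text \<open>Measurability is read off from the closed form of the mean.\<close>

lemma borel_measurable_log_mean:
  assumes [measurable]: "f \<in> borel_measurable M" "g \<in> borel_measurable M"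
    and nn: "\<And>x. x \<in> space M \<Longrightarrow> 0 \<le> f x" "\<And>x. x \<in> space M \<Longrightarrow> 0 \<le> g x"
  shows "(\<lambda>x. log_mean (f x) (g x)) \<in> borel_measurable M"
proof -
  have "(\<lambda>x. if f x = g x then f x else if f x = 0 \<or> g x = 0 then 0
      else (f x - g x) / (ln (f x) - ln (g x))) \<in> borel_measurable M"
    by measurable
  moreover have "log_mean (f x) (g x) = (if f x = g x then f x else if f x = 0 \<or> g x = 0 then 0
      else (f x - g x) / (ln (f x) - ln (g x)))" if "x \<in> space M" for x
    using nn[OF that] by (auto simp: log_mean_same log_mean_zero log_mean_neq)
  ultimately show ?thesis by (simp cong: measurable_cong)
qed

lemma flux_cost_pos:
  "0 < s \<Longrightarrow> 0 < t \<Longrightarrow> flux_cost v s t = ennreal (v\<^sup>2 / log_mean s t)"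
  using log_mean_pos[of s t] by (simp add: flux_cost_def)

lemma flux_cost_scale:
  assumes "0 < c" "0 \<le> s" "0 \<le> t"
  shows "flux_cost (c * v) (c * s) (c * t) = ennreal c * flux_cost v s t"
proof -
  have "ennreal ((c * v)\<^sup>2 / (c * log_mean s t)) = ennreal c * ennreal (v\<^sup>2 / log_mean s t)"
    using assms log_mean_nonneg[of s t]
    by (simp add: power2_eq_square mult.assoc mult.left_commute flip: ennreal_mult)
  then show ?thesis
    using assms by (simp add: flux_cost_def log_mean_scale ennreal_mult_top)
qed

text \<open>The defect in the convexity of \<open>v\<^sup>2 / a\<close> as an explicit square, from which the equality case
  can be read off.\<close>

lemma sum_of_squares_over_weights:
  fixes a b v w :: real
  assumes "0 < a" "0 < b"
  shows "v\<^sup>2 / a + w\<^sup>2 / b = (v + w)\<^sup>2 / (a + b) + (v * b - w * a)\<^sup>2 / (a * b * (a + b))"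
proof -
  have "a + b \<noteq> 0" using assms by simp
  then show ?thesis using assms
    by (simp add: divide_simps) (simp add: power2_eq_square algebra_simps)
qed

text \<open>Superadditivity of the logarithmic mean combines with the convexity of \<open>v\<^sup>2 / \<theta>\<close> in
  \<open>(v, \<theta>)\<close>. The second triple may lie on the boundary, where its mean vanishes: finite cost then
  forces a zero flux, which is why the conclusion is phrased multiplicatively and not with
  quotients.\<close>

lemma flux_cost_superadditive:
  assumes pos: "0 < s1" "0 < t1" "0 \<le> s2" "0 \<le> t2"
  shows "flux_cost (v1 + v2) (s1 + s2) (t1 + t2) \<le> flux_cost v1 s1 t1 + flux_cost v2 s2 t2" (is ?le)
    and "flux_cost v1 s1 t1 + flux_cost v2 s2 t2 \<le> flux_cost (v1 + v2) (s1 + s2) (t1 + t2) \<Longrightarrow>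
      v2 * s1 = s2 * v1 \<and> v2 * t1 = t2 * v1" (is "?ge \<Longrightarrow> ?par")
proof -
  define \<theta>1 \<theta>2 \<theta> where "\<theta>1 = log_mean s1 t1" and "\<theta>2 = log_mean s2 t2" and "\<theta> = log_mean (s1 + s2) (t1 + t2)"
  have \<theta>1: "0 < \<theta>1" and \<theta>2: "0 \<le> \<theta>2" and \<theta>: "0 < \<theta>" and super: "\<theta>1 + \<theta>2 \<le> \<theta>"
    using pos log_mean_pos log_mean_nonneg log_mean_superadditive[OF pos]
    by (simp_all add: \<theta>1_def \<theta>2_def \<theta>_def)
  have sum: "flux_cost (v1 + v2) (s1 + s2) (t1 + t2) = ennreal ((v1 + v2)\<^sup>2 / \<theta>)"
    and one: "flux_cost v1 s1 t1 = ennreal (v1\<^sup>2 / \<theta>1)"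
    using pos by (simp_all add: flux_cost_pos \<theta>_def \<theta>1_def)
  have two: "flux_cost v2 s2 t2 = (if \<theta>2 = 0 then if v2 = 0 then 0 else \<infinity> else ennreal (v2\<^sup>2 / \<theta>2))"
    by (simp add: flux_cost_def \<theta>2_def)
  have parallel: ?par if "v1 * \<theta>2 = v2 * \<theta>1" "v1 = 0 \<or> \<theta> = \<theta>1 + \<theta>2"
  proof (cases "v1 = 0")
    case True
    then show ?thesis using that \<theta>1 by simp
  next
    case False
    then have st: "s1 * t2 = s2 * t1"
      using log_mean_additive_imp_parallel[OF pos] that by (simp add: \<theta>_def \<theta>1_def \<theta>2_def)
    define r where "r = s2 / s1"
    have r: "s2 = r * s1" "t2 = r * t1" "0 \<le> r" using st pos by (auto simp: r_def field_simps)
    have "\<theta>2 = r * \<theta>1" using r pos by (simp add: \<theta>1_def \<theta>2_def log_mean_scale)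
    then have "v2 = r * v1" using that \<theta>1 by (simp add: mult.commute)
    then show ?thesis using r by simp
  qed
  show ?le
  proof (cases "\<theta>2 = 0")
    case True
    then show ?thesis using \<theta>1 \<theta> super by (auto simp: sum one two intro!: ennreal_leI divide_left_mono)
  next
    case False
    then have \<theta>2: "0 < \<theta>2" using \<theta>2 by simp
    have "(v1 + v2)\<^sup>2 / \<theta> \<le> (v1 + v2)\<^sup>2 / (\<theta>1 + \<theta>2)"
      using super \<theta>1 \<theta>2 by (intro divide_left_mono) auto
    also have "\<dots> \<le> v1\<^sup>2 / \<theta>1 + v2\<^sup>2 / \<theta>2"
      using \<theta>1 \<theta>2 by (subst sum_of_squares_over_weights) simp_all
    finally show ?thesis
      using \<theta>1 \<theta>2 False by (simp add: sum one two ennreal_leI flip: ennreal_plus)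
  qed
  show ?par if ?ge
  proof (cases "\<theta>2 = 0")
    case True
    then have v2: "v2 = 0" using that by (auto simp: sum one two top_unique split: if_splits)
    then have "ennreal (v1\<^sup>2 / \<theta>1) \<le> ennreal (v1\<^sup>2 / \<theta>)"
      using that True unfolding sum one two by simp
    then have "v1\<^sup>2 / \<theta>1 \<le> v1\<^sup>2 / \<theta>" using \<theta> by simp
    then have "v1 = 0 \<or> \<theta> = \<theta>1 + \<theta>2"
      using \<theta>1 \<theta> super True by (auto simp: field_simps mult_le_cancel_right)
    then show ?thesis using True v2 by (intro parallel) auto
  next
    case False
    then have \<theta>2: "0 < \<theta>2" using \<theta>2 by simp
    have "v1\<^sup>2 / \<theta>1 + v2\<^sup>2 / \<theta>2 \<le> (v1 + v2)\<^sup>2 / \<theta>"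
      using that False \<theta>1 \<theta>2 \<theta> by (simp add: sum one two flip: ennreal_plus)
    moreover have "(v1 + v2)\<^sup>2 / \<theta> \<le> (v1 + v2)\<^sup>2 / (\<theta>1 + \<theta>2)"
      using super \<theta>1 \<theta>2 by (intro divide_left_mono) auto
    moreover have "0 \<le> (v1 * \<theta>2 - v2 * \<theta>1)\<^sup>2 / (\<theta>1 * \<theta>2 * (\<theta>1 + \<theta>2))" using \<theta>1 \<theta>2 by simp
    ultimately have 1: "(v1 * \<theta>2 - v2 * \<theta>1)\<^sup>2 / (\<theta>1 * \<theta>2 * (\<theta>1 + \<theta>2)) = 0"
      and 2: "(v1 + v2)\<^sup>2 / \<theta> = (v1 + v2)\<^sup>2 / (\<theta>1 + \<theta>2)"
      using sum_of_squares_over_weights[OF \<theta>1 \<theta>2, of v1 v2] by linarith+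
    have e: "v1 * \<theta>2 = v2 * \<theta>1" using 1 \<theta>1 \<theta>2 by simp
    have "v1 + v2 = 0 \<or> \<theta> = \<theta>1 + \<theta>2" using 2 \<theta> \<theta>1 \<theta>2 by (auto simp: field_simps)
    moreover have "v1 = 0" if "v1 + v2 = 0"
    proof -
      have "v1 * (\<theta>1 + \<theta>2) = 0" using e that by (simp add: eq_neg_iff_add_eq_0[symmetric] distrib_left)
      then show ?thesis using \<theta>1 \<theta>2 by simp
    qed
    ultimately show ?thesis using e by (intro parallel) auto
  qed
qed

section \<open>The weighted graph Laplacian of a reversible kernel\<close>

lemma kernel_power_nonneg:
  "markov_kernel K \<Longrightarrow> 0 \<le> kernel_power K n x y"
  by (induction n arbitrary: x) (auto simp: markov_kernel_def intro!: sum_nonneg)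

text \<open>Mass at one state is carried to every other one by some power of the kernel, and
  \<^term>\<open>w\<close> is invariant under all powers.\<close>

lemma invariant_prob_pos:
  assumes K: "markov_kernel K" "irreducible_kernel K" and w: "invariant_prob K w"
  shows "0 < w x"
proof -
  have w0: "\<And>y. 0 \<le> w y" and winv: "\<And>z. w z = (\<Sum>y\<in>UNIV. w y * K y z)"
    using w unfolding invariant_prob_def by blast+
  have inv: "(\<Sum>y\<in>UNIV. w y * kernel_power K n y x) = w x" for n
  proof (induction n)
    case 0
    have "(\<Sum>y\<in>UNIV. w y * kernel_power K 0 y x) = (\<Sum>y\<in>UNIV. if y = x then w y else 0)"
      by (intro sum.cong) auto
    then show ?case by simp
  next
    case (Suc n)
    have "(\<Sum>y\<in>UNIV. w y * kernel_power K (Suc n) y x)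
        = (\<Sum>y\<in>UNIV. \<Sum>z\<in>UNIV. w y * K y z * kernel_power K n z x)"
      by (simp add: sum_distrib_left mult.assoc)
    also have "\<dots> = (\<Sum>z\<in>UNIV. \<Sum>y\<in>UNIV. w y * K y z * kernel_power K n z x)"
      by (rule sum.swap)
    also have "\<dots> = (\<Sum>z\<in>UNIV. (\<Sum>y\<in>UNIV. w y * K y z) * kernel_power K n z x)"
      by (simp only: sum_distrib_right)
    also have "\<dots> = w x" using Suc by (simp flip: winv)
    finally show ?case .
  qed
  obtain y where y: "0 < w y"
  proof -
    have "(\<Sum>y\<in>UNIV. w y) = 1" using w unfolding invariant_prob_def by blast
    then obtain y where "w y \<noteq> 0" by (metis sum.neutral zero_neq_one)
    then show ?thesis using that[of y] w0[of y] by simp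
  qed
  obtain n where "0 < kernel_power K n y x" using K by (auto simp: irreducible_kernel_def)
  then have "0 < w y * kernel_power K n y x" using y by simp
  also have "\<dots> \<le> (\<Sum>y\<in>UNIV. w y * kernel_power K n y x)"
    using w0 kernel_power_nonneg[OF K(1)] by (intro member_le_sum) auto
  finally show ?thesis by (simp only: inv)
qed

lemma irreducible_constant:
  assumes K: "markov_kernel K" "irreducible_kernel K"
    and edge: "\<And>x y. 0 < K x y \<Longrightarrow> f x = f y"
  shows "f x = f y"
proof -
  have "0 < kernel_power K n x y \<Longrightarrow> f x = f y" for n
  proof (induction n arbitrary: x)
    case 0 then show ?case by (simp split: if_splits)
  next
    case (Suc n)
    then obtain z where "0 < K x z * kernel_power K n z y"
      unfolding kernel_power.simps by (meson not_less sum_nonpos)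
    then have "0 < K x z" "0 < kernel_power K n z y"
      using K(1) kernel_power_nonneg[OF K(1), of n z y]
      by (auto simp: markov_kernel_def zero_less_mult_iff dest: order.strict_trans2)
    then show ?case using Suc edge by metis
  qed
  then show ?thesis using K(2) unfolding irreducible_kernel_def by metis
qed

text \<open>Minus twice the divergence is dual to the gradient in the pairings weighted by \<open>K(x, y) w(x)\<close> and
  \<open>w(x)\<close>; reversibility lets the two endpoints of an edge be exchanged.\<close>

lemma summation_by_parts:
  assumes rev: "reversible_wrt K w"
  shows "(\<Sum>x\<in>UNIV. \<Sum>y\<in>UNIV. \<Psi> x y * (\<psi> y - \<psi> x) * (K x y * w x))
    = - 2 * (\<Sum>x\<in>UNIV. \<psi> x * divergence K \<Psi> x * w x)"
proof -
  have "(\<Sum>x\<in>UNIV. \<Sum>y\<in>UNIV. \<Psi> x y * \<psi> y * (K x y * w x))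
      = (\<Sum>y\<in>UNIV. \<Sum>x\<in>UNIV. \<Psi> x y * \<psi> y * (K x y * w x))" by (rule sum.swap)
  also have "\<dots> = (\<Sum>x\<in>UNIV. \<Sum>y\<in>UNIV. \<Psi> y x * \<psi> x * (K x y * w x))"
    using rev by (simp add: reversible_wrt_def)
  finally show ?thesis
    by (simp add: divergence_def right_diff_distrib left_diff_distrib sum_subtractf
        sum_distrib_left sum_distrib_right sum_negf ac_simps)
qed

text \<open>The flux that the potential formulation of the transport problem assigns to \<open>\<psi>\<close>.\<close>

definition gradient_flux :: "('x \<Rightarrow> real) \<Rightarrow> ('x \<Rightarrow> real) \<Rightarrow> 'x \<Rightarrow> 'x \<Rightarrow> real" where
  "gradient_flux \<mu> \<psi> x y = (\<psi> y - \<psi> x) * log_mean (\<mu> x) (\<mu> y)"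

lemma divergence_gradient_flux:
  assumes "\<And>x. 0 \<le> \<mu> x"
  shows "divergence K (gradient_flux \<mu> \<psi>) x
    = (\<Sum>y\<in>UNIV. (\<psi> y - \<psi> x) * log_mean (\<mu> x) (\<mu> y) * K x y)"
proof -
  have "gradient_flux \<mu> \<psi> x y - gradient_flux \<mu> \<psi> y x
      = 2 * ((\<psi> y - \<psi> x) * log_mean (\<mu> x) (\<mu> y))" for y
    using log_mean_commute[of "\<mu> y" "\<mu> x"] assms by (simp add: gradient_flux_def algebra_simps)
  then show ?thesis by (simp add: divergence_def mult.assoc flip: sum_distrib_left)
qed

lemma sum_divergence:
  assumes "reversible_wrt K w"
  shows "(\<Sum>x\<in>UNIV. divergence K \<Psi> x * w x) = 0"
  using summation_by_parts[OF assms, of \<Psi> "\<lambda>_. 1"] by simp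

text \<open>Pairing the divergence with \<open>\<psi>\<close> gives the Dirichlet form, a sum of nonnegative terms over
  edges with positive weights.\<close>

lemma gradient_flux_divergence_free:
  assumes K: "markov_kernel K" "irreducible_kernel K" and w: "invariant_prob K w"
    and rev: "reversible_wrt K w" and \<mu>: "\<And>x. 0 < \<mu> x"
    and div: "\<And>x. divergence K (gradient_flux \<mu> \<psi>) x = 0"
  shows "\<psi> x = \<psi> y"
proof -
  have K0: "\<And>x y. 0 \<le> K x y" using K by (auto simp: markov_kernel_def)
  have w0: "\<And>x. 0 < w x" by (rule invariant_prob_pos[OF K w])
  define T where "T x y = gradient_flux \<mu> \<psi> x y * (\<psi> y - \<psi> x) * (K x y * w x)" for x y
  have T: "T x y = log_mean (\<mu> x) (\<mu> y) * (\<psi> y - \<psi> x)\<^sup>2 * (K x y * w x)" for x y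
    by (simp add: T_def gradient_flux_def power2_eq_square)
  have T0: "0 \<le> T x y" for x y
    unfolding T using log_mean_pos[OF \<mu> \<mu>, of x y] K0[of x y] w0[of x] by simp
  have "(\<Sum>x\<in>UNIV. \<Sum>y\<in>UNIV. T x y) = 0"
    using summation_by_parts[OF rev, of "gradient_flux \<mu> \<psi>" \<psi>] div by (simp add: T_def)
  then have T_zero: "T x y = 0" for x y
    using T0 by (simp add: sum_nonneg_eq_0_iff sum_nonneg)
  have "\<psi> x = \<psi> y" if "0 < K x y" for x y
    using T_zero[of x y] that log_mean_pos[OF \<mu> \<mu>, of x y] w0[of x] by (simp add: T)
  then show ?thesis by (rule irreducible_constant[OF K])
qed

text \<open>The operator \<open>\<psi> \<mapsto> div (gradient_flux \<mu> \<psi>)\<close> kills the constants. Subtracting the rank-one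
  operator \<open>\<psi> \<mapsto> \<Sum>y. w y * \<psi> y\<close> removes this kernel without changing the solutions that have
  mean zero.\<close>

definition laplacian_matrix ::
    "('x::finite \<Rightarrow> 'x \<Rightarrow> real) \<Rightarrow> ('x \<Rightarrow> real) \<Rightarrow> ('x \<Rightarrow> real) \<Rightarrow> real^'x^'x" where
  "laplacian_matrix K w \<mu> = (\<chi> x y. log_mean (\<mu> x) (\<mu> y) * K x y
     - (if x = y then \<Sum>z\<in>UNIV. log_mean (\<mu> x) (\<mu> z) * K x z else 0) - w y)"

text \<open>Cramer's rule, so that the solution depends on the coefficients and the data through sums,
  products and one quotient.\<close>

definition neumann_potential ::
    "('x::finite \<Rightarrow> 'x \<Rightarrow> real) \<Rightarrow> ('x \<Rightarrow> real) \<Rightarrow> ('x \<Rightarrow> real) \<Rightarrow> ('x \<Rightarrow> real) \<Rightarrow> 'x \<Rightarrow> real" where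
  "neumann_potential K w \<mu> f k =
     det (\<chi> i j. if j = k then f i else laplacian_matrix K w \<mu> $ i $ j) / det (laplacian_matrix K w \<mu>)"

lemma laplacian_matrix_mult:
  assumes "\<And>x. 0 \<le> \<mu> x"
  shows "(laplacian_matrix K w \<mu> *v v) $ x
    = divergence K (gradient_flux \<mu> (($) v)) x - (\<Sum>y\<in>UNIV. w y * v $ y)"
proof -
  define c where "c x y = log_mean (\<mu> x) (\<mu> y) * K x y" for x y
  have diag: "(\<Sum>y\<in>UNIV. (if x = y then \<Sum>z\<in>UNIV. c x z else 0) * v $ y) = (\<Sum>z\<in>UNIV. c x z) * v $ x"
    by (simp add: if_distrib[of "\<lambda>t. t * _"] cong: if_cong)
  have "(laplacian_matrix K w \<mu> *v v) $ x
      = (\<Sum>y\<in>UNIV. (c x y - (if x = y then \<Sum>z\<in>UNIV. c x z else 0) - w y) * v $ y)"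
    by (simp add: laplacian_matrix_def matrix_vector_mult_def c_def cong: if_cong)
  also have "\<dots> = (\<Sum>y\<in>UNIV. c x y * v $ y) - (\<Sum>z\<in>UNIV. c x z) * v $ x - (\<Sum>y\<in>UNIV. w y * v $ y)"
    by (simp only: left_diff_distrib sum_subtractf diag)
  also have "(\<Sum>y\<in>UNIV. c x y * v $ y) - (\<Sum>z\<in>UNIV. c x z) * v $ x
      = (\<Sum>y\<in>UNIV. (v $ y - v $ x) * log_mean (\<mu> x) (\<mu> y) * K x y)"
    unfolding sum_distrib_right sum_subtractf[symmetric]
    by (intro sum.cong) (auto simp: c_def algebra_simps)
  finally show ?thesis by (simp add: divergence_gradient_flux[OF assms])
qed

lemma det_laplacian_matrix_nonzero:
  assumes K: "markov_kernel K" "irreducible_kernel K" and w: "invariant_prob K w"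
    and rev: "reversible_wrt K w" and \<mu>: "\<And>x. 0 < \<mu> x"
  shows "det (laplacian_matrix K w \<mu>) \<noteq> 0"
proof -
  have w1: "(\<Sum>x\<in>UNIV. w x) = 1" using w unfolding invariant_prob_def by blast
  have "v = 0" if v: "laplacian_matrix K w \<mu> *v v = 0" for v
  proof -
    let ?m = "\<Sum>y\<in>UNIV. w y * v $ y"
    have *: "divergence K (gradient_flux \<mu> (($) v)) x = ?m" for x
      using laplacian_matrix_mult[of \<mu> K w v x] \<mu> v by (simp add: less_imp_le)
    have m: "?m = 0"
      using sum_divergence[OF rev, of "gradient_flux \<mu> (($) v)"] w1
      unfolding * by (simp flip: sum_distrib_left)
    have const: "v $ x = v $ y" for x y
      by (rule gradient_flux_divergence_free[where \<mu> = \<mu>, OF K w rev \<mu>]) (simp add: * m)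
    have "v $ x = 0" for x
    proof -
      have "?m = (\<Sum>y\<in>UNIV. w y) * v $ x"
        unfolding sum_distrib_right by (intro sum.cong refl arg_cong2[where f = "(*)"] const)
      then show ?thesis using m w1 by simp
    qed
    then show ?thesis by (simp add: vec_eq_iff)
  qed
  then show ?thesis
    by (metis invertible_det_nz invertible_left_inverse matrix_left_invertible_ker)
qed

text \<open>The right-hand side has mean zero, as every divergence does. Taking means in the regularised
  equation shows that the solution has mean zero, so the rank-one term contributes nothing.\<close>

lemma neumann_potential_solves:
  assumes K: "markov_kernel K" "irreducible_kernel K" and w: "invariant_prob K w"
    and rev: "reversible_wrt K w" and \<mu>: "\<And>x. 0 < \<mu> x"
    and f: "(\<Sum>x\<in>UNIV. f x * w x) = 0"
  shows "divergence K (gradient_flux \<mu> (neumann_potential K w \<mu> f)) x = f x"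
proof -
  define v where "v = (\<chi> k. neumann_potential K w \<mu> f k)"
  have vf: "($) v = neumann_potential K w \<mu> f" by (simp add: v_def fun_eq_iff)
  have w1: "(\<Sum>x\<in>UNIV. w x) = 1" using w unfolding invariant_prob_def by blast
  let ?m = "\<Sum>y\<in>UNIV. w y * v $ y"
  have "laplacian_matrix K w \<mu> *v v = (\<chi> x. f x)"
    unfolding cramer[OF det_laplacian_matrix_nonzero[OF K w rev \<mu>]] v_def neumann_potential_def
    by (simp cong: if_cong)
  then have *: "divergence K (gradient_flux \<mu> (($) v)) x = f x + ?m" for x
    using laplacian_matrix_mult[of \<mu> K w v x] \<mu> by (simp add: less_imp_le)
  have "?m = 0"
    using sum_divergence[OF rev, of "gradient_flux \<mu> (($) v)"] w1 f
    unfolding * by (simp add: distrib_right sum.distrib flip: sum_distrib_left)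
  then show ?thesis using * by (simp add: vf)
qed

lemma borel_measurable_neumann_potential:
  fixes \<mu> :: "'a \<Rightarrow> 'x::finite \<Rightarrow> real"
  assumes \<mu>: "\<And>x. (\<lambda>t. \<mu> t x) \<in> borel_measurable M" "\<And>t x. t \<in> space M \<Longrightarrow> 0 \<le> \<mu> t x"
    and f: "\<And>x. (\<lambda>t. f t x) \<in> borel_measurable M"
  shows "(\<lambda>t. neumann_potential K w (\<mu> t) (f t) k) \<in> borel_measurable M"
proof -
  have lm: "(\<lambda>t. log_mean (\<mu> t x) (\<mu> t y)) \<in> borel_measurable M" for x y
    using \<mu> by (intro borel_measurable_log_mean) auto
  have A: "(\<lambda>t. laplacian_matrix K w (\<mu> t) $ i $ j) \<in> borel_measurable M" for i j
    unfolding laplacian_matrix_def using lm by (cases "i = j") (simp_all, measurable)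
  have B: "(\<lambda>t. (\<chi> i j. if j = k then f t i else laplacian_matrix K w (\<mu> t) $ i $ j) $ i $ j)
      \<in> borel_measurable M" for i j
    using A f by (cases "j = k") simp_all
  have det: "(\<lambda>t. det (C t)) \<in> borel_measurable M"
    if "\<And>i j. (\<lambda>t. C t $ i $ j) \<in> borel_measurable M" for C :: "'a \<Rightarrow> real^'x^'x"
    unfolding det_def using that by (intro borel_measurable_sum borel_measurable_times
        borel_measurable_prod borel_measurable_const)
  show ?thesis
    unfolding neumann_potential_def by (intro borel_measurable_divide det A B)
qed

text \<open>Two fluxes with the same divergence differ by one that is orthogonal to all gradient fluxes, so
  this is the Pythagorean inequality. Written edge by edge, it is the nonnegativity of
  \<open>(V - U)\<^sup>2 / \<theta>\<close>, in which the cross term sums to zero.\<close>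

lemma flux_action_gradient_flux_le:
  assumes K0: "\<And>x y. 0 \<le> K x y" and w0: "\<And>x. 0 \<le> w x"
    and rev: "reversible_wrt K w" and \<mu>: "\<And>x. 0 < \<mu> x"
    and div: "\<And>x. divergence K (gradient_flux \<mu> \<psi>) x = divergence K V x"
  shows "ennreal (1/2 * (\<Sum>x\<in>UNIV. \<Sum>y\<in>UNIV. (\<psi> y - \<psi> x)\<^sup>2 * log_mean (\<mu> x) (\<mu> y) * K x y * w x))
    \<le> flux_action K w \<mu> V"
proof -
  define \<theta> where "\<theta> x y = log_mean (\<mu> x) (\<mu> y)" for x y
  define U where "U = gradient_flux \<mu> \<psi>"
  have \<theta>: "0 < \<theta> x y" for x y using \<mu> by (simp add: \<theta>_def log_mean_pos)
  have pt: "(\<psi> y - \<psi> x)\<^sup>2 * \<theta> x y * K x y * w x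
      + 2 * (V x y * (\<psi> y - \<psi> x) * (K x y * w x) - U x y * (\<psi> y - \<psi> x) * (K x y * w x))
      \<le> (V x y)\<^sup>2 / \<theta> x y * (K x y * w x)" for x y
  proof -
    have "0 \<le> (V x y - U x y)\<^sup>2 / \<theta> x y" using \<theta>[of x y] by simp
    also have "\<dots> = (V x y)\<^sup>2 / \<theta> x y - ((\<psi> y - \<psi> x)\<^sup>2 * \<theta> x y
        + 2 * (V x y * (\<psi> y - \<psi> x) - U x y * (\<psi> y - \<psi> x)))"
      using \<theta>[of x y]
      by (simp add: U_def gradient_flux_def \<theta>_def[symmetric] divide_simps) (simp add: power2_eq_square algebra_simps)
    finally have "((\<psi> y - \<psi> x)\<^sup>2 * \<theta> x y + 2 * (V x y * (\<psi> y - \<psi> x) - U x y * (\<psi> y - \<psi> x))) * (K x y * w x)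
        \<le> (V x y)\<^sup>2 / \<theta> x y * (K x y * w x)"
      using K0 w0 by (intro mult_right_mono) auto
    then show ?thesis by (simp add: algebra_simps)
  qed
  have orth: "(\<Sum>x\<in>UNIV. \<Sum>y\<in>UNIV. V x y * (\<psi> y - \<psi> x) * (K x y * w x))
      = (\<Sum>x\<in>UNIV. \<Sum>y\<in>UNIV. U x y * (\<psi> y - \<psi> x) * (K x y * w x))"
    using summation_by_parts[OF rev, of V \<psi>] summation_by_parts[OF rev, of U \<psi>] div
    by (simp add: U_def)
  have "(\<Sum>x\<in>UNIV. \<Sum>y\<in>UNIV. (\<psi> y - \<psi> x)\<^sup>2 * \<theta> x y * K x y * w x)
      = (\<Sum>x\<in>UNIV. \<Sum>y\<in>UNIV. (\<psi> y - \<psi> x)\<^sup>2 * \<theta> x y * K x y * w x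
      + 2 * (V x y * (\<psi> y - \<psi> x) * (K x y * w x) - U x y * (\<psi> y - \<psi> x) * (K x y * w x)))"
    using orth by (simp add: sum.distrib sum_subtractf flip: sum_distrib_left)
  also have "\<dots> \<le> (\<Sum>x\<in>UNIV. \<Sum>y\<in>UNIV. (V x y)\<^sup>2 / \<theta> x y * (K x y * w x))"
    by (intro sum_mono pt)
  finally have le: "1/2 * (\<Sum>x\<in>UNIV. \<Sum>y\<in>UNIV. (\<psi> y - \<psi> x)\<^sup>2 * \<theta> x y * K x y * w x)
      \<le> 1/2 * (\<Sum>x\<in>UNIV. \<Sum>y\<in>UNIV. (V x y)\<^sup>2 / \<theta> x y * (K x y * w x))" by simp
  define q where "q x y = (V x y)\<^sup>2 / \<theta> x y * (K x y * w x)" for x y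
  have q: "0 \<le> q x y" for x y
    using \<theta>[of x y] K0 w0 by (simp add: q_def)
  have "flux_cost (V x y) (\<mu> x) (\<mu> y) * ennreal (K x y * w x) = ennreal (q x y)" for x y
    using \<theta>[of x y] K0 w0 by (simp add: q_def flux_cost_pos[OF \<mu> \<mu>] flip: \<theta>_def ennreal_mult)
  then have "flux_action K w \<mu> V = ennreal (1/2) * (\<Sum>x\<in>UNIV. \<Sum>y\<in>UNIV. ennreal (q x y))"
    by (simp add: flux_action_def)
  also have "\<dots> = ennreal (1/2) * ennreal (\<Sum>x\<in>UNIV. \<Sum>y\<in>UNIV. q x y)"
    using q by (simp add: sum_ennreal sum_nonneg)
  also have "\<dots> = ennreal (1/2 * (\<Sum>x\<in>UNIV. \<Sum>y\<in>UNIV. q x y))"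
    using q by (intro ennreal_mult[symmetric] sum_nonneg) auto
  finally show ?thesis using le by (simp only: \<theta>_def q_def ennreal_leI)
qed

section \<open>Absolutely continuous functions\<close>

lemma abs_continuous_on_Icc_subinterval:
  assumes "abs_continuous_on_Icc c d f" "c \<le> u" "v \<le> d"
  shows "abs_continuous_on_Icc u v f"
  unfolding abs_continuous_on_Icc_def
proof (intro allI impI)
  fix \<epsilon> :: real assume "\<epsilon> > 0"
  then obtain \<delta> where \<delta>: "\<delta> > 0" and *: "\<And>(n::nat) l r.
      (\<forall>i<n. c \<le> l i \<and> l i \<le> r i \<and> r i \<le> d) \<and>
      (\<forall>i<n. \<forall>j<n. i \<noteq> j \<longrightarrow> {l i<..<r i} \<inter> {l j<..<r j} = {}) \<and>
      (\<Sum>i<n. r i - l i) < \<delta> \<Longrightarrow> (\<Sum>i<n. \<bar>f (r i) - f (l i)\<bar>) < \<epsilon>"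
    using assms(1) unfolding abs_continuous_on_Icc_def by blast
  show "\<exists>\<delta>>0. \<forall>(n::nat) l r.
        (\<forall>i<n. u \<le> l i \<and> l i \<le> r i \<and> r i \<le> v) \<and>
        (\<forall>i<n. \<forall>j<n. i \<noteq> j \<longrightarrow> {l i<..<r i} \<inter> {l j<..<r j} = {}) \<and>
        (\<Sum>i<n. r i - l i) < \<delta> \<longrightarrow> (\<Sum>i<n. \<bar>f (r i) - f (l i)\<bar>) < \<epsilon>"
  proof (intro exI[of _ \<delta>] conjI \<delta> allI impI, elim conjE)
    fix n :: nat and l r
    assume "\<forall>i<n. u \<le> l i \<and> l i \<le> r i \<and> r i \<le> v"
      "\<forall>i<n. \<forall>j<n. i \<noteq> j \<longrightarrow> {l i<..<r i} \<inter> {l j<..<r j} = {}" "(\<Sum>i<n. r i - l i) < \<delta>"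
    then show "(\<Sum>i<n. \<bar>f (r i) - f (l i)\<bar>) < \<epsilon>"
      using assms(2,3) by (intro *) (meson order_trans)
  qed
qed

text \<open>Covers affine images, midpoints and quotients of absolutely continuous functions at once.\<close>

lemma abs_continuous_on_Icc_dominated:
  assumes f: "abs_continuous_on_Icc c d f" and g: "abs_continuous_on_Icc c d g" and C: "0 \<le> C"
    and dom: "\<And>s t. s \<in> {c..d} \<Longrightarrow> t \<in> {c..d} \<Longrightarrow>
      \<bar>q t - q s\<bar> \<le> C * (\<bar>f t - f s\<bar> + \<bar>g t - g s\<bar>)"
  shows "abs_continuous_on_Icc c d q"
  unfolding abs_continuous_on_Icc_def
proof (intro allI impI)
  fix \<epsilon> :: real assume \<epsilon>: "\<epsilon> > 0"
  define \<eta> where "\<eta> = \<epsilon> / (2 * (C + 1))"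
  have \<eta>: "\<eta> > 0" using \<epsilon> C by (simp add: \<eta>_def)
  obtain \<delta>1 where \<delta>1: "\<delta>1 > 0" and *: "\<And>(n::nat) l r.
      (\<forall>i<n. c \<le> l i \<and> l i \<le> r i \<and> r i \<le> d) \<and>
      (\<forall>i<n. \<forall>j<n. i \<noteq> j \<longrightarrow> {l i<..<r i} \<inter> {l j<..<r j} = {}) \<and>
      (\<Sum>i<n. r i - l i) < \<delta>1 \<Longrightarrow> (\<Sum>i<n. \<bar>f (r i) - f (l i)\<bar>) < \<eta>"
    using f \<eta> unfolding abs_continuous_on_Icc_def by blast
  obtain \<delta>2 where \<delta>2: "\<delta>2 > 0" and **: "\<And>(n::nat) l r.
      (\<forall>i<n. c \<le> l i \<and> l i \<le> r i \<and> r i \<le> d) \<and>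
      (\<forall>i<n. \<forall>j<n. i \<noteq> j \<longrightarrow> {l i<..<r i} \<inter> {l j<..<r j} = {}) \<and>
      (\<Sum>i<n. r i - l i) < \<delta>2 \<Longrightarrow> (\<Sum>i<n. \<bar>g (r i) - g (l i)\<bar>) < \<eta>"
    using g \<eta> unfolding abs_continuous_on_Icc_def by blast
  show "\<exists>\<delta>>0. \<forall>(n::nat) l r.
        (\<forall>i<n. c \<le> l i \<and> l i \<le> r i \<and> r i \<le> d) \<and>
        (\<forall>i<n. \<forall>j<n. i \<noteq> j \<longrightarrow> {l i<..<r i} \<inter> {l j<..<r j} = {}) \<and>
        (\<Sum>i<n. r i - l i) < \<delta> \<longrightarrow> (\<Sum>i<n. \<bar>q (r i) - q (l i)\<bar>) < \<epsilon>"
  proof (intro exI[of _ "min \<delta>1 \<delta>2"] conjI allI impI, goal_cases)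
    case 1 then show ?case using \<delta>1 \<delta>2 by simp
  next
    case (2 n l r)
    then have h: "\<And>i. i < n \<Longrightarrow> l i \<in> {c..d} \<and> r i \<in> {c..d}" by force
    have "(\<Sum>i<n. \<bar>q (r i) - q (l i)\<bar>)
        \<le> (\<Sum>i<n. C * (\<bar>f (r i) - f (l i)\<bar> + \<bar>g (r i) - g (l i)\<bar>))"
      using h by (intro sum_mono dom) auto
    also have "\<dots> = C * ((\<Sum>i<n. \<bar>f (r i) - f (l i)\<bar>) + (\<Sum>i<n. \<bar>g (r i) - g (l i)\<bar>))"
      by (simp add: sum.distrib flip: sum_distrib_left)
    also have "\<dots> \<le> C * (\<eta> + \<eta>)"
      using *[of n l r] **[of n l r] 2 C by (intro mult_left_mono add_mono) auto
    also have "\<dots> < (C + 1) * (\<eta> + \<eta>)" using \<eta> by simp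
    also have "\<dots> = \<eta> * (2 * (C + 1))" by (simp add: algebra_simps)
    also have "\<dots> = \<epsilon>" using C by (simp add: \<eta>_def)
    finally show ?case .
  qed
qed

lemma abs_continuous_on_Icc_imp_continuous_on:
  assumes "abs_continuous_on_Icc c d f"
  shows "continuous_on {c..d} f"
  unfolding continuous_on_iff
proof (intro ballI allI impI)
  fix x e :: real assume x: "x \<in> {c..d}" and e: "e > 0"
  obtain \<delta> where \<delta>: "\<delta> > 0" and *: "\<And>(n::nat) l r.
      (\<forall>i<n. c \<le> l i \<and> l i \<le> r i \<and> r i \<le> d) \<and>
      (\<forall>i<n. \<forall>j<n. i \<noteq> j \<longrightarrow> {l i<..<r i} \<inter> {l j<..<r j} = {}) \<and>
      (\<Sum>i<n. r i - l i) < \<delta> \<Longrightarrow> (\<Sum>i<n. \<bar>f (r i) - f (l i)\<bar>) < e"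
    using assms e unfolding abs_continuous_on_Icc_def by blast
  have 1: "\<bar>f v - f u\<bar> < e" if "c \<le> u" "u \<le> v" "v \<le> d" "v - u < \<delta>" for u v
    using *[of 1 "\<lambda>_. u" "\<lambda>_. v"] that by simp
  show "\<exists>d'>0. \<forall>x'\<in>{c..d}. dist x' x < d' \<longrightarrow> dist (f x') (f x) < e"
  proof (intro exI[of _ \<delta>] conjI \<delta> ballI impI)
    fix x' assume "x' \<in> {c..d}" "dist x' x < \<delta>"
    then show "dist (f x') (f x) < e"
      using 1[of x x'] 1[of x' x] x by (cases "x \<le> x'") (auto simp: dist_real_def abs_if split: if_splits)
  qed
qed

text \<open>A gauge is built from two requirements. At a point of differentiability the increment over a
  small interval is nearly linear, as in the classical theorem. At a point of the exceptional null
  set the gauge keeps the interval inside an open set of small measure; the intervals with such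
  tags have small total length, and absolute continuity makes their total increment small. The
  derivative is set to zero on the null set, which does not affect the integral.\<close>

lemma fundamental_theorem_of_calculus_abs_continuous:
  fixes f f' :: "real \<Rightarrow> real"
  assumes ac: "abs_continuous_on_Icc c d f" and cd: "c \<le> d" and N: "negligible N"
    and der: "\<And>t. t \<in> {c..d} - N \<Longrightarrow> (f has_real_derivative f' t) (at t within {c..d})"
  shows "(f' has_integral (f d - f c)) {c..d}"
proof -
  define F where "F t = (if t \<in> N then 0 else f' t)" for t
  have "(F has_integral (f d - f c)) (cbox c d)"
    unfolding has_integral
  proof (intro allI impI)
    fix e :: real assume e: "e > 0"
    define e' where "e' = e / (2 * (d - c + 1))"
    have e': "e' > 0" using e cd by (simp add: e'_def)
    have "\<forall>x. \<exists>\<rho>>0. x \<in> {c..d} - N \<longrightarrow>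
        (\<forall>y\<in>{c..d}. \<bar>y - x\<bar> < \<rho> \<longrightarrow> \<bar>f y - f x - (y - x) * f' x\<bar> \<le> e' * \<bar>y - x\<bar>)"
    proof
      fix x
      show "\<exists>\<rho>>0. x \<in> {c..d} - N \<longrightarrow>
        (\<forall>y\<in>{c..d}. \<bar>y - x\<bar> < \<rho> \<longrightarrow> \<bar>f y - f x - (y - x) * f' x\<bar> \<le> e' * \<bar>y - x\<bar>)"
        using der[of x] e'
        unfolding has_field_derivative_def has_derivative_within_alt
        by (cases "x \<in> {c..d} - N") (auto simp: mult.commute intro: exI[of _ 1])
    qed
    then obtain \<rho> where \<rho>0: "\<And>x. \<rho> x > 0" and
      \<rho>: "\<And>x y. x \<in> {c..d} - N \<Longrightarrow> y \<in> {c..d} \<Longrightarrow> \<bar>y - x\<bar> < \<rho> x \<Longrightarrow>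
            \<bar>f y - f x - (y - x) * f' x\<bar> \<le> e' * \<bar>y - x\<bar>"
      by metis
    obtain \<delta> where \<delta>: "\<delta> > 0" and small: "\<And>(n::nat) l r.
        (\<forall>i<n. c \<le> l i \<and> l i \<le> r i \<and> r i \<le> d) \<and>
        (\<forall>i<n. \<forall>j<n. i \<noteq> j \<longrightarrow> {l i<..<r i} \<inter> {l j<..<r j} = {}) \<and>
        (\<Sum>i<n. r i - l i) < \<delta> \<Longrightarrow> (\<Sum>i<n. \<bar>f (r i) - f (l i)\<bar>) < e / 2"
      using ac half_gt_zero[OF e] unfolding abs_continuous_on_Icc_def by blast
    obtain T where T: "open T" "N \<subseteq> T" "T \<in> lmeasurable" "measure lebesgue T < \<delta>"
    proof -
      have Nm: "N \<in> sets lebesgue" and N0: "emeasure lebesgue N = 0"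
        using N by (auto simp: negligible_iff_null_sets null_sets_def)
      obtain T where "open T" "N \<subseteq> T" "(T - N) \<in> lmeasurable" "emeasure lebesgue (T - N) < ennreal \<delta>"
        using sets_lebesgue_outer_open[OF Nm \<delta>] by metis
      moreover have "T \<in> lmeasurable"
        using calculation negligible_imp_measurable[OF N] fmeasurable.Un[of "T - N" lebesgue N]
        by (simp add: Un_absorb2)
      moreover have "emeasure lebesgue T \<le> emeasure lebesgue (T - N) + emeasure lebesgue N"
        using emeasure_subadditive[of "T - N" lebesgue N] calculation Nm
        by (auto simp: Un_absorb2 fmeasurableD)
      ultimately show ?thesis
        using N0 that[of T] \<delta> by (auto simp: emeasure_eq_measure2 ennreal_less_iff)
    qed
    have "\<forall>x. \<exists>\<sigma>>0. x \<in> N \<longrightarrow> ball x \<sigma> \<subseteq> T"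
      using T by (metis open_contains_ball subsetD zero_less_one)
    then obtain \<sigma> where \<sigma>0: "\<And>x. \<sigma> x > 0" and \<sigma>: "\<And>x. x \<in> N \<Longrightarrow> ball x (\<sigma> x) \<subseteq> T"
      by metis
    \<comment> \<open>The radius \<open>\<rho>\<close> matters for tags outside \<open>N\<close>, and \<open>\<sigma>\<close> for tags in \<open>N\<close>.\<close>
    define \<gamma> where "\<gamma> x = ball x (min (\<rho> x) (\<sigma> x))" for x
    have "gauge \<gamma>" unfolding \<gamma>_def using \<rho>0 \<sigma>0 by (intro gauge_ball_dependent) auto
    moreover have "norm ((\<Sum>(x, k)\<in>P. measure lborel k *\<^sub>R F x) - (f d - f c)) < e"
      if P: "P tagged_division_of cbox c d" and fine: "\<gamma> fine P" for P
    proof -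
      have fin: "finite P" using P by blast
      define lo where "lo z = Inf (snd z)" for z :: "real \<times> real set"
      define hi where "hi z = Sup (snd z)" for z :: "real \<times> real set"
      have box: "snd z = {lo z..hi z} \<and> lo z \<le> fst z \<and> fst z \<le> hi z \<and> c \<le> lo z \<and> hi z \<le> d
          \<and> {lo z..hi z} \<subseteq> \<gamma> (fst z)" if z: "z \<in> P" for z
      proof -
        obtain x k where xk: "z = (x, k)" by force
        have "x \<in> k" "k \<subseteq> cbox c d" "\<exists>u v. k = cbox u v"
          using tagged_division_ofD(2-4)[OF P] z xk by blast+
        then obtain u v where k: "k = {u..v}" "u \<le> x" "x \<le> v" "c \<le> u" "v \<le> d" by auto
        moreover have "k \<subseteq> \<gamma> x" using fine z xk by (auto simp: fine_def)
        ultimately show ?thesis by (simp add: xk lo_def hi_def)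
      qed
      have content_snd: "measure lborel (snd z) = hi z - lo z" if "z \<in> P" for z
        using box[OF that] by (metis content_real order_trans)
      have tele: "f d - f c = (\<Sum>z\<in>P. f (hi z) - f (lo z))" "d - c = (\<Sum>z\<in>P. hi z - lo z)"
        using additive_tagged_division_1[of c d P f] additive_tagged_division_1[of c d P "\<lambda>x. x"]
          P cd by (simp_all add: lo_def hi_def case_prod_unfold)
      define Q where "Q = {z \<in> P. fst z \<in> N}"
      have finQ: "finite Q" "Q \<subseteq> P" using fin by (auto simp: Q_def)
      have good: "(\<Sum>z\<in>P - Q. \<bar>(hi z - lo z) * F (fst z) - (f (hi z) - f (lo z))\<bar>) \<le> e' * (d - c)"
      proof -
        have "\<bar>(hi z - lo z) * F (fst z) - (f (hi z) - f (lo z))\<bar> \<le> e' * (hi z - lo z)"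
          if "z \<in> P - Q" for z
        proof -
          let ?x = "fst z"
          have x: "?x \<in> {c..d} - N" and zP: "z \<in> P" using box[of z] that by (auto simp: Q_def)
          have lx: "\<bar>f (lo z) - f ?x - (lo z - ?x) * f' ?x\<bar> \<le> e' * \<bar>lo z - ?x\<bar>"
            and hx: "\<bar>f (hi z) - f ?x - (hi z - ?x) * f' ?x\<bar> \<le> e' * \<bar>hi z - ?x\<bar>"
            using box[OF zP] x
            by (intro \<rho>; force simp: \<gamma>_def dist_real_def abs_minus_commute subset_iff)+
          have "\<bar>(hi z - lo z) * F ?x - (f (hi z) - f (lo z))\<bar>
              = \<bar>(f (lo z) - f ?x - (lo z - ?x) * f' ?x) - (f (hi z) - f ?x - (hi z - ?x) * f' ?x)\<bar>"
            using x by (simp add: F_def algebra_simps)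
          also have "\<dots> \<le> e' * \<bar>lo z - ?x\<bar> + e' * \<bar>hi z - ?x\<bar>" using lx hx by linarith
          also have "\<dots> = e' * (hi z - lo z)" using box[OF zP] by (simp add: algebra_simps)
          finally show ?thesis .
        qed
        then have "(\<Sum>z\<in>P - Q. \<bar>(hi z - lo z) * F (fst z) - (f (hi z) - f (lo z))\<bar>)
            \<le> (\<Sum>z\<in>P - Q. e' * (hi z - lo z))" by (intro sum_mono)
        also have "\<dots> \<le> (\<Sum>z\<in>P. e' * (hi z - lo z))"
          using fin box e' by (intro sum_mono2) (auto intro!: mult_nonneg_nonneg simp: diff_ge_0_iff_ge dest!: box)
        also have "\<dots> = e' * (d - c)" by (simp add: tele(2) sum_distrib_left)
        finally show ?thesis .
      qed
      have bad: "(\<Sum>z\<in>Q. \<bar>(hi z - lo z) * F (fst z) - (f (hi z) - f (lo z))\<bar>) < e / 2"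
      proof -
        obtain g where g: "bij_betw g {..<card Q} Q"
          using ex_bij_betw_nat_finite[OF finQ(1)] by (auto simp: atLeast0LessThan)
        have gP: "g i \<in> P" "g i \<in> Q" if "i < card Q" for i
          using g finQ that by (auto simp: bij_betw_def)
        have dist: "{lo (g i)<..<hi (g i)} \<inter> {lo (g j)<..<hi (g j)} = {}"
          if ij: "i < card Q" "j < card Q" "i \<noteq> j" for i j
        proof -
          have "g i \<noteq> g j" using g ij by (auto simp: bij_betw_def inj_on_def)
          then have "interior (snd (g i)) \<inter> interior (snd (g j)) = {}"
            using tagged_division_ofD(5)[OF P, of "fst (g i)" "snd (g i)" "fst (g j)" "snd (g j)"]
              gP ij by simp
          then show ?thesis using box gP(1)[OF ij(1)] gP(1)[OF ij(2)] by (metis interior_atLeastAtMost_real)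
        qed
        have len: "(\<Sum>z\<in>Q. hi z - lo z) < \<delta>"
        proof -
          have Qp: "Q tagged_partial_division_of cbox c d"
            using P finQ(2) by (meson tagged_division_of_def tagged_partial_division_subset)
          note Qt = tagged_partial_division_of_Union_self[OF Qp]
          have "(\<Sum>z\<in>Q. hi z - lo z) = (\<Sum>(x,k)\<in>Q. measure lborel k)"
            using content_snd finQ by (intro sum.cong) (auto simp: case_prod_unfold)
          also have "\<dots> = (\<Sum>k\<in>snd ` Q. measure lborel k)"
            by (intro sum.over_tagged_division_lemma[OF Qt]) (auto simp: content_eq_0_interior)
          also have "\<dots> = (\<Sum>k\<in>snd ` Q. measure lebesgue k)"
          proof (rule sum.cong[OF refl])
            fix k assume "k \<in> snd ` Q"
            then obtain z where "z \<in> P" "k = snd z" using finQ by auto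
            then have "k = {lo z..hi z}" using box[of z] by simp
            then show "measure lborel k = measure lebesgue k" by simp
          qed
          also have "\<dots> = measure lebesgue (\<Union>(snd ` Q))"
            by (intro content_division division_of_tagged_division[OF Qt])
          also have "\<dots> \<le> measure lebesgue T"
          proof (rule measure_mono_fmeasurable[OF _ _ T(3)])
            show "\<Union>(snd ` Q) \<subseteq> T"
            proof
              fix t assume "t \<in> \<Union>(snd ` Q)"
              then obtain z where z: "z \<in> Q" "t \<in> snd z" by auto
              then have "t \<in> \<gamma> (fst z)" "fst z \<in> N" using box[of z] by (auto simp: Q_def)
              then show "t \<in> T" using \<sigma>[of "fst z"] by (auto simp: \<gamma>_def)
            qed
            have "\<And>z. z \<in> Q \<Longrightarrow> closed (snd z)" using box finQ by (metis closed_atLeastAtMost subsetD)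
            then have "closed (\<Union>(snd ` Q))" using finQ by (intro closed_Union) auto
            then show "\<Union>(snd ` Q) \<in> sets lebesgue" by simp
          qed
          finally show ?thesis using T(4) by simp
        qed
        have "(\<Sum>z\<in>Q. \<bar>(hi z - lo z) * F (fst z) - (f (hi z) - f (lo z))\<bar>)
            = (\<Sum>z\<in>Q. \<bar>f (hi z) - f (lo z)\<bar>)"
          by (intro sum.cong) (auto simp: Q_def F_def)
        also have "\<dots> = (\<Sum>i<card Q. \<bar>f (hi (g i)) - f (lo (g i))\<bar>)"
          by (rule sum.reindex_bij_betw[OF g, symmetric])
        also have "\<dots> < e / 2"
        proof (rule small)
          have "\<forall>i<card Q. c \<le> lo (g i) \<and> lo (g i) \<le> hi (g i) \<and> hi (g i) \<le> d"
            using box[OF gP(1)] by (meson order_trans)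
          moreover have "(\<Sum>i<card Q. hi (g i) - lo (g i)) < \<delta>"
            using len sum.reindex_bij_betw[OF g, of "\<lambda>z. hi z - lo z"] by simp
          ultimately show "(\<forall>i<card Q. c \<le> lo (g i) \<and> lo (g i) \<le> hi (g i) \<and> hi (g i) \<le> d) \<and>
              (\<forall>i<card Q. \<forall>j<card Q. i \<noteq> j \<longrightarrow> {lo (g i)<..<hi (g i)} \<inter> {lo (g j)<..<hi (g j)} = {}) \<and>
              (\<Sum>i<card Q. hi (g i) - lo (g i)) < \<delta>"
            using dist by blast
        qed
        finally show ?thesis .
      qed
      have "(\<Sum>(x, k)\<in>P. measure lborel k *\<^sub>R F x) = (\<Sum>z\<in>P. (hi z - lo z) * F (fst z))"
        using content_snd by (intro sum.cong) (auto simp: case_prod_unfold)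
      then have "(\<Sum>(x, k)\<in>P. measure lborel k *\<^sub>R F x) - (f d - f c)
          = (\<Sum>z\<in>P. (hi z - lo z) * F (fst z) - (f (hi z) - f (lo z)))"
        by (simp add: tele(1) sum_subtractf)
      then have "norm ((\<Sum>(x, k)\<in>P. measure lborel k *\<^sub>R F x) - (f d - f c))
          \<le> (\<Sum>z\<in>P. \<bar>(hi z - lo z) * F (fst z) - (f (hi z) - f (lo z))\<bar>)"
        by (simp only: real_norm_def sum_abs)
      also have "\<dots> = (\<Sum>z\<in>P - Q. \<bar>(hi z - lo z) * F (fst z) - (f (hi z) - f (lo z))\<bar>)
          + (\<Sum>z\<in>Q. \<bar>(hi z - lo z) * F (fst z) - (f (hi z) - f (lo z))\<bar>)"
        by (rule sum.subset_diff[OF finQ(2) fin])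
      also have "\<dots> < e' * (d - c) + e / 2" using good bad by simp
      also have "\<dots> \<le> e"
        using e cd by (simp add: e'_def field_simps)
      finally show ?thesis .
    qed
    ultimately show "\<exists>\<gamma>. gauge \<gamma> \<and> (\<forall>\<D>. \<D> tagged_division_of cbox c d \<and> \<gamma> fine \<D> \<longrightarrow>
        norm ((\<Sum>(x, k)\<in>\<D>. measure lborel k *\<^sub>R F x) - (f d - f c)) < e)"
      by (intro exI[of _ \<gamma>]) simp
  qed
  then show ?thesis
    using has_integral_spike[OF N, of "cbox c d" f' F "f d - f c"] by (simp add: F_def)
qed


text \<open>At a maximum point of \<open>\<bar>f\<bar>\<close>, integrating the differential inequality bounds the maximum by half
  of itself.\<close>

lemma abs_continuous_eq_0_short_interval:
  fixes f g :: "real \<Rightarrow> real"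
  assumes ac: "abs_continuous_on_Icc c d f" and N: "negligible N" and fc: "f c = 0"
    and g: "g integrable_on {c..d}" and g0: "\<And>t. t \<in> {c..d} \<Longrightarrow> 0 \<le> g t"
    and small: "integral {c..d} g \<le> 1/2"
    and der: "\<And>t. t \<in> {c..d} - N \<Longrightarrow>
      \<exists>D. (f has_real_derivative D) (at t within {c..d}) \<and> \<bar>D\<bar> \<le> g t * \<bar>f t\<bar>"
    and t: "t \<in> {c..d}"
  shows "f t = 0"
proof -
  have "continuous_on {c..d} (\<lambda>t. \<bar>f t\<bar>)"
    using abs_continuous_on_Icc_imp_continuous_on[OF ac] by (intro continuous_intros)
  then obtain m where m: "m \<in> {c..d}" "\<And>s. s \<in> {c..d} \<Longrightarrow> \<bar>f s\<bar> \<le> \<bar>f m\<bar>"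
    using continuous_attains_sup[of "{c..d}" "\<lambda>t. \<bar>f t\<bar>"] t by auto
  obtain D where D: "\<And>t. t \<in> {c..d} - N \<Longrightarrow>
      (f has_real_derivative D t) (at t within {c..d}) \<and> \<bar>D t\<bar> \<le> g t * \<bar>f t\<bar>"
    using der by metis
  have "(D has_integral (f m - f c)) {c..m}"
  proof (rule fundamental_theorem_of_calculus_abs_continuous[OF _ _ N])
    show "abs_continuous_on_Icc c m f"
      using abs_continuous_on_Icc_subinterval[OF ac, of c m] m by simp
    show "(f has_real_derivative D t) (at t within {c..m})" if "t \<in> {c..m} - N" for t
      using D[of t] that m by (auto intro: DERIV_subset)
  qed (use m in auto)
  then have 1: "((\<lambda>t. if t \<in> N then 0 else D t) has_integral f m) {c..m}"
    using has_integral_spike[OF N, of "{c..m}" "\<lambda>t. if t \<in> N then 0 else D t" D] fc by simp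
  have gm: "g integrable_on {c..m}"
    using integrable_on_subinterval[OF g] m by auto
  have "norm (integral {c..m} (\<lambda>t. if t \<in> N then 0 else D t)) \<le> integral {c..m} (\<lambda>t. g t * \<bar>f m\<bar>)"
  proof (rule integral_norm_bound_integral)
    show "norm (if s \<in> N then 0 else D s) \<le> g s * \<bar>f m\<bar>" if s: "s \<in> {c..m}" for s
    proof (cases "s \<in> N")
      case False
      have "\<bar>D s\<bar> \<le> g s * \<bar>f s\<bar>" using D[of s] s m False by simp
      also have "\<dots> \<le> g s * \<bar>f m\<bar>" using m s g0 by (intro mult_left_mono) auto
      finally show ?thesis using False by simp
    qed (use g0 s m in auto)
  qed (use 1 gm in \<open>auto intro: integrable_on_mult_left\<close>)
  then have "\<bar>f m\<bar> \<le> integral {c..m} g * \<bar>f m\<bar>" using integral_unique[OF 1] by simp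
  also have "\<dots> \<le> 1/2 * \<bar>f m\<bar>"
  proof (rule mult_right_mono)
    have "integral {c..m} g \<le> integral {c..d} g"
      using m g gm g0 by (intro integral_subset_le) auto
    then show "integral {c..m} g \<le> 1/2" using small by simp
  qed simp
  finally show ?thesis using m(2)[OF t] by simp
qed

text \<open>The largest initial interval on which \<^term>\<open>f\<close> vanishes can be extended by any interval on
  which \<^term>\<open>g\<close> has integral at most \<open>1/2\<close>, and such an interval exists because the indefinite
  integral is continuous.\<close>

lemma abs_continuous_gronwall:
  fixes f g :: "real \<Rightarrow> real"
  assumes ac: "abs_continuous_on_Icc c d f" and N: "negligible N" and fc: "f c = 0"
    and g: "g integrable_on {c..d}" and g0: "\<And>t. t \<in> {c..d} \<Longrightarrow> 0 \<le> g t"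
    and der: "\<And>t. t \<in> {c..d} - N \<Longrightarrow>
      \<exists>D. (f has_real_derivative D) (at t within {c..d}) \<and> \<bar>D\<bar> \<le> g t * \<bar>f t\<bar>"
    and t: "t \<in> {c..d}"
  shows "f t = 0"
proof -
  define S where "S = {u \<in> {c..d}. \<forall>s\<in>{c..u}. f s = 0}"
  have cS: "c \<in> S" using fc t by (auto simp: S_def)
  have bdd: "bdd_above S" by (auto simp: S_def bdd_above_def)
  define T where "T = Sup S"
  have cT: "c \<le> T" unfolding T_def using cS bdd by (rule cSup_upper)
  have Td: "T \<le> d" unfolding T_def using cS by (intro cSup_least) (auto simp: S_def)
  have below: "f s = 0" if "c \<le> s" "s < T" for s
  proof -
    have "\<exists>u\<in>S. s < u" using less_cSup_iff[of S s] cS bdd that by (auto simp: T_def)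
    then show ?thesis using that by (auto simp: S_def)
  qed
  have cont: "continuous_on {c..d} f" by (rule abs_continuous_on_Icc_imp_continuous_on[OF ac])
  have fT: "f T = 0"
  proof (cases "c = T")
    case False
    have "continuous_on (closure {c..<T}) f"
      using cT Td False by (auto intro!: continuous_on_subset[OF cont])
    then show ?thesis
      using continuous_constant_on_closure[of "{c..<T}" f 0 T] below cT False by simp
  qed (use fc in simp)
  show ?thesis
  proof (rule ccontr)
    assume "f t \<noteq> 0"
    have lt: "T < d"
    proof (rule ccontr)
      assume "\<not> T < d"
      then have "T = d" using Td by simp
      then show False using below[of t] fT t \<open>f t \<noteq> 0\<close> by (cases "t = d") auto
    qed
    have gT: "g integrable_on {T..d}" using integrable_on_subinterval[OF g, of T d] cT by simp
    have "continuous_on {T..d} (\<lambda>x. integral {T..x} g)"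
      by (rule indefinite_integral_continuous_1[OF gT])
    then obtain \<delta> where \<delta>: "\<delta> > 0" "\<And>x. x \<in> {T..d} \<Longrightarrow> dist x T < \<delta> \<Longrightarrow> dist (integral {T..x} g) (integral {T..T} g) < 1/2"
      using lt unfolding continuous_on_iff by (metis atLeastAtMost_iff half_gt_zero_iff less_eq_real_def zero_less_one)
    define v where "v = min d (T + \<delta>/2)"
    have v: "T < v" "v \<le> d" "dist v T < \<delta>" using lt \<delta>(1) by (auto simp: v_def dist_real_def)
    have "f s = 0" if "s \<in> {T..v}" for s
    proof (rule abs_continuous_eq_0_short_interval[where f = f and g = g and c = T and d = v, OF _ N fT _ _ _ _ that])
      show "abs_continuous_on_Icc T v f" using abs_continuous_on_Icc_subinterval[OF ac] cT v by simp
      show "g integrable_on {T..v}" using integrable_on_subinterval[OF gT] v by simp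
      show "integral {T..v} g \<le> 1/2" using \<delta>(2)[of v] v by (simp add: dist_real_def)
      show "\<exists>D. (f has_real_derivative D) (at t within {T..v}) \<and> \<bar>D\<bar> \<le> g t * \<bar>f t\<bar>"
        if t: "t \<in> {T..v} - N" for t
      proof -
        have "{T..v} \<subseteq> {c..d}" using v cT by auto
        moreover obtain D where "(f has_real_derivative D) (at t within {c..d})" "\<bar>D\<bar> \<le> g t * \<bar>f t\<bar>"
          using der[of t] t v cT by auto
        ultimately show ?thesis using DERIV_subset by blast
      qed
    qed (use g0 v cT in auto)
    then have "\<forall>s\<in>{c..v}. f s = 0" using below by (metis atLeastAtMost_iff not_less)
    then have "v \<in> S" using v cT by (simp add: S_def)
    then have "v \<le> T" unfolding T_def using bdd by (rule cSup_upper)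
    then show False using v by simp
  qed
qed

lemma abs_continuous_on_Icc_affine: "abs_continuous_on_Icc c d (\<lambda>t. \<alpha> + \<beta> * t)"
proof (rule abs_continuous_on_Icc_dominated[where f = "\<lambda>t. t" and g = "\<lambda>t. t" and C = "\<bar>\<beta>\<bar>"])
  show "abs_continuous_on_Icc c d (\<lambda>t. t)" "abs_continuous_on_Icc c d (\<lambda>t. t)"
    unfolding abs_continuous_on_Icc_def by (force intro!: exI[of _ "_::real"])+
  show "\<bar>\<alpha> + \<beta> * t - (\<alpha> + \<beta> * s)\<bar> \<le> \<bar>\<beta>\<bar> * (\<bar>t - s\<bar> + \<bar>t - s\<bar>)" for s t :: real
    by (simp add: abs_mult flip: right_diff_distrib)
qed simp

lemma borel_measurable_abs_continuous:
  "abs_continuous_on_Icc c d f \<Longrightarrow> f \<in> borel_measurable (lebesgue_on {c..d})"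
  by (intro continuous_imp_measurable_on_sets_lebesgue abs_continuous_on_Icc_imp_continuous_on) auto

section \<open>Comparison of the flux action with the transport distance\<close>

lemma borel_measurable_flux_action:
  assumes \<mu>: "\<And>x. (\<lambda>t. \<mu> t x) \<in> borel_measurable M" "\<And>t x. t \<in> space M \<Longrightarrow> 0 \<le> \<mu> t x"
    and V[measurable]: "\<And>x y. (\<lambda>t. V t x y) \<in> borel_measurable M"
  shows "(\<lambda>t. flux_action K w (\<mu> t) (V t)) \<in> borel_measurable M"
proof -
  have [measurable]: "(\<lambda>t. log_mean (\<mu> t x) (\<mu> t y)) \<in> borel_measurable M" for x y
    using \<mu> by (intro borel_measurable_log_mean) auto
  show ?thesis unfolding flux_action_def flux_cost_def by measurable
qed

text \<open>At each time the flux is replaced by the gradient flux with the same divergence. Positivity of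
  the curve on the whole interval makes the Laplacian invertible at every time.\<close>

lemma W_squared_le_E_Quad:
  fixes K :: "'x::finite \<Rightarrow> 'x \<Rightarrow> real"
  assumes K: "markov_kernel K" "irreducible_kernel K" and w: "invariant_prob K w"
    and rev: "reversible_wrt K w"
    and CE: "(\<mu>, V, h) \<in> CE K p \<mu>0 \<mu>1"
    and pos: "\<And>t x. t \<in> {0..1} \<Longrightarrow> 0 < \<mu> t x"
  shows "W_squared K w p a b \<mu>0 \<mu>1 \<le> E_Quad K w a b (\<mu>, V, h)"
proof -
  let ?M = "lebesgue_on {0..1::real}"
  define f where "f t x = divergence K (V t) x" for t x
  define \<psi> where "\<psi> t = neumann_potential K w (\<mu> t) (f t)" for t
  have K0: "\<And>x y. 0 \<le> K x y" and w0: "\<And>x. 0 \<le> w x"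
    using K invariant_prob_pos[OF K w] by (auto simp: markov_kernel_def less_imp_le)
  have solves: "divergence K (gradient_flux (\<mu> t) (\<psi> t)) x = divergence K (V t) x" if "t \<in> {0..1}" for t x
    using neumann_potential_solves[where \<mu> = "\<mu> t" and f = "f t" and x = x, OF K w rev pos[OF that]] sum_divergence[OF rev, of "V t"]
    by (simp add: \<psi>_def f_def)
  have \<mu>_meas: "(\<lambda>t. \<mu> t x) \<in> borel_measurable ?M" for x
    using CE by (auto simp: CE_def admissible_curve_def intro: borel_measurable_abs_continuous)
  have V_meas: "(\<lambda>t. V t x y) \<in> borel_measurable ?M" for x y using CE by (simp add: CE_def)
  have f_meas: "(\<lambda>t. f t x) \<in> borel_measurable ?M" for x
    unfolding f_def divergence_def
    by (intro borel_measurable_times borel_measurable_const borel_measurable_sum borel_measurable_diff V_meas)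
  have "(\<lambda>t. \<psi> t x) \<in> borel_measurable ?M" for x
    unfolding \<psi>_def using pos
    by (intro borel_measurable_neumann_potential \<mu>_meas f_meas) (auto simp: less_imp_le)
  moreover have "AE t in ?M. \<forall>x. \<exists>d. ((\<lambda>s. \<mu> s x) has_real_derivative d) (at t within {0..1}) \<and>
        d + (\<Sum>y\<in>UNIV. (\<psi> t y - \<psi> t x) * log_mean (\<mu> t x) (\<mu> t y) * K x y) = h t * p x"
  proof (rule AE_mp)
    show "AE t in ?M. \<forall>x. \<exists>d. ((\<lambda>s. \<mu> s x) has_real_derivative d) (at t within {0..1}) \<and>
        d + divergence K (V t) x = h t * p x"
      using CE by (simp add: CE_def)
    show "AE t in ?M. (\<forall>x. \<exists>d. ((\<lambda>s. \<mu> s x) has_real_derivative d) (at t within {0..1}) \<and>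
        d + divergence K (V t) x = h t * p x) \<longrightarrow>
      (\<forall>x. \<exists>d. ((\<lambda>s. \<mu> s x) has_real_derivative d) (at t within {0..1}) \<and>
        d + (\<Sum>y\<in>UNIV. (\<psi> t y - \<psi> t x) * log_mean (\<mu> t x) (\<mu> t y) * K x y) = h t * p x)"
    proof (rule AE_I2)
      fix t assume "t \<in> space ?M"
      then have t: "t \<in> {0..1}" by simp
      have "(\<Sum>y\<in>UNIV. (\<psi> t y - \<psi> t x) * log_mean (\<mu> t x) (\<mu> t y) * K x y) = divergence K (V t) x" for x
        using solves[OF t, of x] divergence_gradient_flux[of "\<mu> t" K "\<psi> t" x] pos[OF t]
        by (simp add: less_imp_le)
      then show "(\<forall>x. \<exists>d. ((\<lambda>s. \<mu> s x) has_real_derivative d) (at t within {0..1}) \<and>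
        d + divergence K (V t) x = h t * p x) \<longrightarrow>
      (\<forall>x. \<exists>d. ((\<lambda>s. \<mu> s x) has_real_derivative d) (at t within {0..1}) \<and>
        d + (\<Sum>y\<in>UNIV. (\<psi> t y - \<psi> t x) * log_mean (\<mu> t x) (\<mu> t y) * K x y) = h t * p x)"
        by simp
    qed
  qed
  ultimately have "(\<mu>, \<psi>, h) \<in> potential_triples K p \<mu>0 \<mu>1"
    using CE by (simp add: CE_def potential_triples_def)
  moreover have "potential_action K w a b (\<mu>, \<psi>, h) \<le> E_Quad K w a b (\<mu>, V, h)"
    unfolding potential_action_def E_Quad_def prod.case power2_abs
    by (intro add_mono mult_left_mono nn_integral_mono order_refl flux_action_gradient_flux_le K0 w0 rev pos solves)
       auto
  ultimately show ?thesis unfolding W_squared_def by (rule INF_lower2)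
qed

text \<open>The competitor interpolates linearly between the endpoints, with a source rate and a flux that do
  not depend on time. The rate \<^term>\<open>c\<close> is the growth of total mass per unit time; with it
  the change that the source leaves over has mean zero, so it is the divergence of a flux. The curve is bounded away from
  zero, so its cost is bounded in time.\<close>

lemma W_squared_finite:
  fixes K :: "'x::finite \<Rightarrow> 'x \<Rightarrow> real"
  assumes K: "markov_kernel K" "irreducible_kernel K" and w: "invariant_prob K w"
    and rev: "reversible_wrt K w" and p: "(\<Sum>x\<in>UNIV. p x * w x) = 1"
    and pos: "\<And>x. 0 < \<mu>0 x" "\<And>x. 0 < \<mu>1 x"
  shows "W_squared K w p a b \<mu>0 \<mu>1 < \<infinity>"
proof -
  let ?M = "lebesgue_on {0..1::real}"
  have K0: "\<And>x y. 0 \<le> K x y" and w0: "\<And>x. 0 \<le> w x"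
    using K invariant_prob_pos[OF K w] by (auto simp: markov_kernel_def less_imp_le)
  define \<mu> where "\<mu> t x = \<mu>0 x + (\<mu>1 x - \<mu>0 x) * t" for t x
  define c where "c = (\<Sum>x\<in>UNIV. (\<mu>1 x - \<mu>0 x) * w x)"
  define f where "f x = c * p x - (\<mu>1 x - \<mu>0 x)" for x
  define V where "V = gradient_flux (\<lambda>_. 1) (neumann_potential K w (\<lambda>_. 1) f)"
  have "(\<Sum>x\<in>UNIV. f x * w x) = c * (\<Sum>x\<in>UNIV. p x * w x) - c"
    by (simp add: f_def c_def left_diff_distrib sum_subtractf sum_distrib_left mult.assoc)
  then have div: "divergence K V x = f x" for x
    unfolding V_def using p by (intro neumann_potential_solves[OF K w rev]) auto
  define m where "m = Min (range \<mu>0 \<union> range \<mu>1)"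
  have m_in: "m \<in> range \<mu>0 \<union> range \<mu>1" unfolding m_def by (rule Min_in) auto
  then have m0: "0 < m" using pos by auto
  have m_le: "m \<le> \<mu>0 x" "m \<le> \<mu>1 x" for x unfolding m_def by (auto intro!: Min_le)
  have \<mu>_ge: "m \<le> \<mu> t x" if "t \<in> {0..1}" for t x
  proof -
    have "m = (1 - t) * m + t * m" by (simp add: algebra_simps)
    also have "\<dots> \<le> (1 - t) * \<mu>0 x + t * \<mu>1 x" using that m_le by (intro add_mono mult_left_mono) auto
    also have "\<dots> = \<mu> t x" by (simp add: \<mu>_def algebra_simps)
    finally show ?thesis .
  qed
  have "(\<mu>, \<lambda>_. V, \<lambda>_. c) \<in> CE K p \<mu>0 \<mu>1"
    unfolding CE_def mem_Collect_eq prod.case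
  proof (intro conjI allI AE_I2)
    show "admissible_curve \<mu>0 \<mu>1 \<mu>"
      unfolding admissible_curve_def
    proof (intro conjI ballI allI)
      show "0 \<le> \<mu> t x" if "t \<in> {0..1}" for t x using \<mu>_ge[OF that, of x] m0 by simp
      show "abs_continuous_on_Icc 0 1 (\<lambda>t. \<mu> t x)" for x
        unfolding \<mu>_def by (rule abs_continuous_on_Icc_affine)
    qed (simp_all add: \<mu>_def fun_eq_iff)
    show "\<exists>d. ((\<lambda>s. \<mu> s x) has_real_derivative d) (at t within {0..1}) \<and> d + divergence K V x = c * p x" for t x
      by (intro exI[of _ "\<mu>1 x - \<mu>0 x"])
         (auto simp: \<mu>_def div f_def intro!: derivative_eq_intros)
  qed auto
  then have "W_squared K w p a b \<mu>0 \<mu>1 \<le> E_Quad K w a b (\<mu>, \<lambda>_. V, \<lambda>_. c)"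
    using \<mu>_ge m0 by (intro W_squared_le_E_Quad[OF K w rev]) (auto intro: less_le_trans)
  also have "\<dots> < \<infinity>"
  proof -
    define B where "B = ennreal (1/2) * (\<Sum>x\<in>UNIV. \<Sum>y\<in>UNIV. ennreal ((V x y)\<^sup>2 / m) * ennreal (K x y * w x))"
    have "flux_action K w (\<mu> t) V \<le> B" if t: "t \<in> {0..1}" for t
      unfolding flux_action_def B_def
    proof (intro mult_left_mono sum_mono mult_right_mono)
      fix x y
      have "0 < \<mu> t x" "0 < \<mu> t y" "m \<le> log_mean (\<mu> t x) (\<mu> t y)"
        using \<mu>_ge[OF t] m0 by (auto intro: less_le_trans log_mean_ge)
      then show "flux_cost (V x y) (\<mu> t x) (\<mu> t y) \<le> ennreal ((V x y)\<^sup>2 / m)"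
        using m0 by (auto simp: flux_cost_pos intro!: ennreal_leI divide_left_mono mult_pos_pos log_mean_pos)
    qed auto
    then have "(\<integral>\<^sup>+t. flux_action K w (\<mu> t) V \<partial>?M) \<le> (\<integral>\<^sup>+t. B \<partial>?M)"
      by (intro nn_integral_mono) simp
    also have "\<dots> = B" by (simp add: emeasure_restrict_space)
    also have "\<dots> < \<infinity>" 
      unfolding B_def infinity_ennreal_def
      by (simp add: ennreal_mult_less_top ennreal_mult_eq_top_iff flip: less_top)
    finally have 1: "(\<integral>\<^sup>+t. flux_action K w (\<mu> t) V \<partial>?M) < \<infinity>" .
    have "(\<integral>\<^sup>+t. ennreal (\<bar>c\<bar>\<^sup>2) \<partial>?M) = ennreal (\<bar>c\<bar>\<^sup>2)"
      by (simp add: emeasure_restrict_space)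
    then show ?thesis unfolding E_Quad_def prod.case using 1
      by (simp add: ennreal_mult_less_top)
  qed
  finally show ?thesis .
qed

section \<open>Equality in integrals and finite sums\<close>

lemma ennreal_sum_le_imp_eq:
  fixes f g :: "'a \<Rightarrow> ennreal"
  assumes A: "finite A" and le: "\<And>i. i \<in> A \<Longrightarrow> f i \<le> g i"
    and ge: "sum g A \<le> sum f A" and fin: "sum f A < \<infinity>" and i: "i \<in> A"
  shows "f i = g i"
proof (rule ccontr)
  assume "f i \<noteq> g i"
  then have less: "f i < g i" using le[OF i] by simp
  have "sum f A = sum f (A - {i}) + f i" using A i by (simp add: sum.remove add.commute)
  also have "\<dots> < sum f (A - {i}) + g i"
    using fin less sum.remove[OF A i, of f] by (auto simp: ennreal_add_left_cancel_less)
  also have "\<dots> \<le> sum g (A - {i}) + g i" using le by (intro add_mono sum_mono) auto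
  also have "\<dots> = sum g A" using A i by (simp add: sum.remove add.commute)
  finally show False using ge by simp
qed

lemma ennreal_add_le_imp_eq:
  fixes x x' y y' :: ennreal
  assumes "x \<le> x'" "y \<le> y'" "x' + y' \<le> x + y" "x + y < \<infinity>"
  shows "x = x'" "y = y'"
  using ennreal_sum_le_imp_eq[of UNIV "\<lambda>b. if b then x else y" "\<lambda>b. if b then x' else y'" True]
    ennreal_sum_le_imp_eq[of UNIV "\<lambda>b. if b then x else y" "\<lambda>b. if b then x' else y'" False] assms
  by (auto simp: UNIV_bool add.commute split: if_splits)

lemma nn_integral_ge_imp_AE_eq:
  assumes f: "f \<in> borel_measurable M" and g: "g \<in> borel_measurable M"
    and le: "AE x in M. f x \<le> g x" and ge: "integral\<^sup>N M g \<le> integral\<^sup>N M f"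
    and fin: "integral\<^sup>N M f < \<infinity>"
  shows "AE x in M. f x = g x"
proof -
  have "integral\<^sup>N M f = integral\<^sup>N M g" using nn_integral_mono_AE[OF le] ge by simp
  then have "(\<integral>\<^sup>+x. g x - f x \<partial>M) = 0"
    using nn_integral_diff[OF g f _ le] fin by simp
  then have "AE x in M. g x - f x = 0"
    using f g by (subst (asm) nn_integral_0_iff_AE) auto
  with le show ?thesis
    by eventually_elim (metis antisym ennreal_minus_eq_0)
qed

section \<open>Midpoints of curves\<close>

lemma has_real_derivative_midpoint:
  assumes "(f has_real_derivative d) (at t within S)" "(g has_real_derivative e) (at t within S)"
  shows "((\<lambda>s. (f s + g s) / 2) has_real_derivative (d + e) / 2) (at t within S)"
  using DERIV_cdivide[OF DERIV_add[OF assms], of 2] by simp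

lemma divergence_midpoint:
  "divergence K (\<lambda>x y. (V x y + V' x y) / 2) x = (divergence K V x + divergence K V' x) / 2"
proof -
  have "(\<Sum>y\<in>UNIV. ((V x y + V' x y) / 2 - (V y x + V' y x) / 2) * K x y)
      = ((\<Sum>y\<in>UNIV. (V x y - V y x) * K x y) + (\<Sum>y\<in>UNIV. (V' x y - V' y x) * K x y)) / 2"
    unfolding sum.distrib[symmetric] sum_divide_distrib
    by (intro sum.cong) (auto simp: field_simps)
  then show ?thesis by (simp add: divergence_def)
qed

lemma CE_midpoint:
  assumes c1: "(\<mu>, V, h) \<in> CE K p \<mu>0 \<mu>1" and c2: "(\<mu>', V', h') \<in> CE K p \<mu>0 \<mu>1"
  shows "(\<lambda>t x. (\<mu> t x + \<mu>' t x) / 2, \<lambda>t x y. (V t x y + V' t x y) / 2, \<lambda>t. (h t + h' t) / 2)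
    \<in> CE K p \<mu>0 \<mu>1"
  unfolding CE_def mem_Collect_eq prod.case
proof (intro conjI)
  have c1': "admissible_curve \<mu>0 \<mu>1 \<mu>" "\<And>x y. (\<lambda>t. V t x y) \<in> borel_measurable (lebesgue_on {0..1})"
    "h \<in> borel_measurable (lebesgue_on {0..1})"
    "AE t in lebesgue_on {0..1}. \<forall>x. \<exists>d. ((\<lambda>s. \<mu> s x) has_real_derivative d) (at t within {0..1}) \<and>
        d + divergence K (V t) x = h t * p x"
    using c1 by (auto simp: CE_def)
  have c2': "admissible_curve \<mu>0 \<mu>1 \<mu>'" "\<And>x y. (\<lambda>t. V' t x y) \<in> borel_measurable (lebesgue_on {0..1})"
    "h' \<in> borel_measurable (lebesgue_on {0..1})"
    "AE t in lebesgue_on {0..1}. \<forall>x. \<exists>d. ((\<lambda>s. \<mu>' s x) has_real_derivative d) (at t within {0..1}) \<and>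
        d + divergence K (V' t) x = h' t * p x"
    using c2 by (auto simp: CE_def)
  show "admissible_curve \<mu>0 \<mu>1 (\<lambda>t x. (\<mu> t x + \<mu>' t x) / 2)"
    unfolding admissible_curve_def
  proof (intro conjI ballI allI)
    show "abs_continuous_on_Icc 0 1 (\<lambda>t. (\<mu> t x + \<mu>' t x) / 2)" for x
      by (rule abs_continuous_on_Icc_dominated[where f = "\<lambda>t. \<mu> t x" and g = "\<lambda>t. \<mu>' t x" and C = 1])
         (use c1'(1) c2'(1) in \<open>simp_all add: admissible_curve_def, simp add: abs_if field_simps\<close>)
    show "0 \<le> (\<mu> t x + \<mu>' t x) / 2" if "t \<in> {0..1}" for t x
      using c1'(1) c2'(1) that by (simp add: admissible_curve_def)
  qed (use c1'(1) c2'(1) in \<open>auto simp: admissible_curve_def fun_eq_iff\<close>)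
  show "\<forall>x y. (\<lambda>t. (V t x y + V' t x y) / 2) \<in> borel_measurable (lebesgue_on {0..1})"
    "(\<lambda>t. (h t + h' t) / 2) \<in> borel_measurable (lebesgue_on {0..1})"
    using c1'(2,3) c2'(2,3) by auto
  show "AE t in lebesgue_on {0..1}. \<forall>x. \<exists>d.
       ((\<lambda>s. (\<mu> s x + \<mu>' s x) / 2) has_real_derivative d) (at t within {0..1}) \<and>
       d + divergence K (\<lambda>x y. (V t x y + V' t x y) / 2) x = (h t + h' t) / 2 * p x"
    using c1'(4) c2'(4)
  proof eventually_elim
    case (elim t)
    show ?case
    proof
      fix x
      obtain d e where d: "((\<lambda>s. \<mu> s x) has_real_derivative d) (at t within {0..1})"
          "d + divergence K (V t) x = h t * p x"
        and e: "((\<lambda>s. \<mu>' s x) has_real_derivative e) (at t within {0..1})"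
          "e + divergence K (V' t) x = h' t * p x"
        using elim by blast
      have "(d + e) / 2 + (divergence K (V t) x + divergence K (V' t) x) / 2 = (h t + h' t) / 2 * p x"
        using d(2) e(2) by (simp add: field_simps)
      then show "\<exists>d. ((\<lambda>s. (\<mu> s x + \<mu>' s x) / 2) has_real_derivative d) (at t within {0..1}) \<and>
          d + divergence K (\<lambda>x y. (V t x y + V' t x y) / 2) x = (h t + h' t) / 2 * p x"
        using has_real_derivative_midpoint[OF d(1) e(1)] by (auto simp: divergence_midpoint)
    qed
  qed
qed

text \<open>By 1-homogeneity twice the cost at a midpoint is the cost of the sum of the two triples, so the
  claims are superadditivity of the edge cost and its equality case, weighted by the edges.\<close>

lemma flux_action_midpoint:
  assumes pos: "\<And>x. 0 < \<mu> x" "\<And>x. 0 \<le> \<mu>' x"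
  shows "2 * flux_action K w (\<lambda>x. (\<mu> x + \<mu>' x) / 2) (\<lambda>x y. (V x y + V' x y) / 2)
      \<le> flux_action K w \<mu> V + flux_action K w \<mu>' V'" 
    and "\<lbrakk>flux_action K w \<mu> V + flux_action K w \<mu>' V'
        \<le> 2 * flux_action K w (\<lambda>x. (\<mu> x + \<mu>' x) / 2) (\<lambda>x y. (V x y + V' x y) / 2);
      2 * flux_action K w (\<lambda>x. (\<mu> x + \<mu>' x) / 2) (\<lambda>x y. (V x y + V' x y) / 2) < \<infinity>;
      0 < K x y; 0 < w x\<rbrakk> \<Longrightarrow>
      V' x y * \<mu> x = \<mu>' x * V x y \<and> V' x y * \<mu> y = \<mu>' y * V x y"
proof -
  let ?mid = "flux_action K w (\<lambda>x. (\<mu> x + \<mu>' x) / 2) (\<lambda>x y. (V x y + V' x y) / 2)"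
  let ?avg = "flux_action K w \<mu> V + flux_action K w \<mu>' V'"
  define f where "f x y = flux_cost (V x y + V' x y) (\<mu> x + \<mu>' x) (\<mu> y + \<mu>' y) * ennreal (K x y * w x)" for x y
  define g where "g x y = (flux_cost (V x y) (\<mu> x) (\<mu> y) + flux_cost (V' x y) (\<mu>' x) (\<mu>' y)) * ennreal (K x y * w x)" for x y
  have half: "2 * ennreal (1/2) = 1"
    by (subst ennreal_numeral[symmetric], subst ennreal_mult[symmetric]) auto
  have "flux_cost ((V x y + V' x y) / 2) ((\<mu> x + \<mu>' x) / 2) ((\<mu> y + \<mu>' y) / 2)
      = ennreal (1/2) * flux_cost (V x y + V' x y) (\<mu> x + \<mu>' x) (\<mu> y + \<mu>' y)" for x y
    using flux_cost_scale[of "1/2" "\<mu> x + \<mu>' x" "\<mu> y + \<mu>' y" "V x y + V' x y"] pos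
    by (simp add: add_nonneg_nonneg less_imp_le)
  then have "?mid = ennreal (1/2) * (\<Sum>x\<in>UNIV. \<Sum>y\<in>UNIV. ennreal (1/2) * f x y)"
    by (simp add: flux_action_def f_def mult.assoc del: ennreal_half)
  then have mid: "2 * ?mid = ennreal (1/2) * (\<Sum>x\<in>UNIV. \<Sum>y\<in>UNIV. f x y)"
    using half by (simp only: mult.assoc[symmetric] mult_1_left sum_distrib_left[symmetric])
  have avg: "?avg = ennreal (1/2) * (\<Sum>x\<in>UNIV. \<Sum>y\<in>UNIV. g x y)"
    by (simp only: flux_action_def g_def distrib_right distrib_left sum.distrib)
  have fg: "f x y \<le> g x y" for x y
    unfolding f_def g_def using pos by (intro mult_right_mono flux_cost_superadditive) auto
  show "2 * ?mid \<le> ?avg" unfolding mid avg by (intro mult_left_mono sum_mono fg) auto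
  show "V' x y * \<mu> x = \<mu>' x * V x y \<and> V' x y * \<mu> y = \<mu>' y * V x y"
    if ge: "?avg \<le> 2 * ?mid" and fin: "2 * ?mid < \<infinity>" and K: "0 < K x y" and w: "0 < w x"
  proof (rule flux_cost_superadditive)
    have ge': "(\<Sum>x\<in>UNIV. \<Sum>y\<in>UNIV. g x y) \<le> (\<Sum>x\<in>UNIV. \<Sum>y\<in>UNIV. f x y)"
      using ge unfolding mid avg by (subst (asm) ennreal_mult_le_mult_iff) auto
    have fin': "(\<Sum>x\<in>UNIV. \<Sum>y\<in>UNIV. f x y) < \<infinity>"
      using fin unfolding mid by (auto simp: ennreal_mult_less_top)
    have row: "(\<Sum>y\<in>UNIV. f x y) = (\<Sum>y\<in>UNIV. g x y)"
      by (rule ennreal_sum_le_imp_eq[OF _ _ ge' fin']) (auto intro: sum_mono fg)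
    moreover have "(\<Sum>y\<in>UNIV. f x y) < \<infinity>"
      using fin' by (auto simp: less_top[symmetric])
    ultimately have "f x y = g x y"
      by (intro ennreal_sum_le_imp_eq[of UNIV "f x" "g x"]) (auto intro: fg)
    then show "flux_cost (V x y) (\<mu> x) (\<mu> y) + flux_cost (V' x y) (\<mu>' x) (\<mu>' y)
        \<le> flux_cost (V x y + V' x y) (\<mu> x + \<mu>' x) (\<mu> y + \<mu>' y)"
      using K w unfolding f_def g_def
      by (metis ennreal_eq_0_iff ennreal_mult_le_mult_iff ennreal_neq_top mult.commute mult_pos_pos not_le order_refl)
  qed (use pos in auto)
qed

section \<open>Uniqueness of minimizers\<close>

text \<open>Twice the density of the action at the midpoint is at most the sum of the two densities, while
  its integral is at least as large because both curves are minimizers. Finiteness turns this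
  into equality almost everywhere, separately for the source term and for the transport term.\<close>

lemma minimizers_parallel:
  fixes K :: "'x::finite \<Rightarrow> 'x \<Rightarrow> real"
  assumes K: "markov_kernel K" "irreducible_kernel K" and w: "invariant_prob K w"
    and rev: "reversible_wrt K w" and ab: "0 < a" "0 < b"
    and p: "(\<Sum>x\<in>UNIV. p x * w x) = 1"
    and ends: "\<And>x. 0 < \<mu>0 x" "\<And>x. 0 < \<mu>1 x"
    and CE: "(\<mu>, V, h) \<in> CE K p \<mu>0 \<mu>1" "(\<mu>', V', h') \<in> CE K p \<mu>0 \<mu>1"
    and min: "E_Quad K w a b (\<mu>, V, h) = W_squared K w p a b \<mu>0 \<mu>1"
      "E_Quad K w a b (\<mu>', V', h') = W_squared K w p a b \<mu>0 \<mu>1"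
    and pos: "\<And>t x. t \<in> {0..1} \<Longrightarrow> 0 < \<mu> t x"
  shows "AE t in lebesgue_on {0..1}. h t = h' t \<and> (\<forall>x y. 0 < K x y \<longrightarrow>
    V' t x y * \<mu> t x = \<mu>' t x * V t x y \<and> V' t x y * \<mu> t y = \<mu>' t y * V t x y)"
proof -
  let ?M = "lebesgue_on {0..1::real}"
  define \<nu> where "\<nu> t x = (\<mu> t x + \<mu>' t x) / 2" for t x
  define U where "U t x y = (V t x y + V' t x y) / 2" for t x y
  define k where "k t = (h t + h' t) / 2" for t
  have mid: "(\<nu>, U, k) \<in> CE K p \<mu>0 \<mu>1"
    using CE_midpoint[OF CE] unfolding \<nu>_def[abs_def] U_def[abs_def] k_def[abs_def] .
  define dens where "dens h A = ennreal (a\<^sup>2) * ennreal (h\<^sup>2) + ennreal (b\<^sup>2) * A" for h :: real and A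
  have meas: "h \<in> borel_measurable ?M \<and> (\<lambda>t. flux_action K w (\<mu> t) (V t)) \<in> borel_measurable ?M"
    if "(\<mu>, V, h) \<in> CE K p \<mu>0 \<mu>1" for \<mu> V h
  proof -
    have "abs_continuous_on_Icc 0 1 (\<lambda>t. \<mu> t x)" "(\<lambda>t. V t x y) \<in> borel_measurable ?M"
      "h \<in> borel_measurable ?M" "\<And>t. t \<in> space ?M \<Longrightarrow> 0 \<le> \<mu> t x" for x y
      using that by (auto simp: CE_def admissible_curve_def)
    then show ?thesis
      by (intro conjI borel_measurable_flux_action) (auto intro: borel_measurable_abs_continuous)
  qed
  have dens_meas: "(\<lambda>t. dens (h t) (flux_action K w (\<mu> t) (V t))) \<in> borel_measurable ?M"
    if "(\<mu>, V, h) \<in> CE K p \<mu>0 \<mu>1" for \<mu> V h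
  proof -
    note [measurable] = meas[OF that, THEN conjunct1] meas[OF that, THEN conjunct2]
    show ?thesis unfolding dens_def by measurable
  qed
  have E: "E_Quad K w a b (\<mu>, V, h) = (\<integral>\<^sup>+t. dens (h t) (flux_action K w (\<mu> t) (V t)) \<partial>?M)"
    if "(\<mu>, V, h) \<in> CE K p \<mu>0 \<mu>1" for \<mu> V h
  proof -
    note [measurable] = meas[OF that, THEN conjunct1] meas[OF that, THEN conjunct2]
    show ?thesis
      unfolding E_Quad_def dens_def prod.case power2_abs
      by (simp add: nn_integral_add nn_integral_cmult)
  qed
  define F where "F t = dens (h t) (flux_action K w (\<mu> t) (V t)) + dens (h' t) (flux_action K w (\<mu>' t) (V' t))" for t
  define G where "G t = 2 * dens (k t) (flux_action K w (\<nu> t) (U t))" for t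
  have F_meas: "F \<in> borel_measurable ?M"
    unfolding F_def using dens_meas[OF CE(1)] dens_meas[OF CE(2)] by (rule borel_measurable_add)
  have G_meas: "G \<in> borel_measurable ?M"
    unfolding G_def using dens_meas[OF mid] by (intro borel_measurable_times_ennreal borel_measurable_const)
  have nonneg': "0 \<le> \<mu>' t x" if "t \<in> {0..1}" for t x
    using CE(2) that by (simp add: CE_def admissible_curve_def)
  \<comment> \<open>The parallelogram law: the last square is the strict convexity gap of the source term.\<close>
  have h_mid: "(k t)\<^sup>2 * 2 + (h t - h' t)\<^sup>2 / 2 = (h t)\<^sup>2 + (h' t)\<^sup>2" for t
    by (simp add: k_def power2_eq_square field_simps)
  define P where "P t = ennreal (a\<^sup>2) * ennreal (2 * (k t)\<^sup>2)" for t
  define P' where "P' t = ennreal (a\<^sup>2) * ennreal ((h t)\<^sup>2 + (h' t)\<^sup>2)" for t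
  define Q where "Q t = ennreal (b\<^sup>2) * (2 * flux_action K w (\<nu> t) (U t))" for t
  define Q' where "Q' t = ennreal (b\<^sup>2) * (flux_action K w (\<mu> t) (V t) + flux_action K w (\<mu>' t) (V' t))" for t
  have G_PQ: "G t = P t + Q t" for t
    by (simp add: G_def dens_def P_def Q_def ennreal_mult distrib_left mult.left_commute)
  have F_PQ: "F t = P' t + Q' t" for t
    by (simp add: F_def dens_def P'_def Q'_def ennreal_plus distrib_left ac_simps)
  have PP: "P t \<le> P' t" for t
    unfolding P_def P'_def using h_mid[of t] zero_le_power2[of "h t - h' t"]
    by (intro mult_left_mono ennreal_leI zero_le) linarith
  have QQ: "Q t \<le> Q' t" if "t \<in> {0..1}" for t
    unfolding Q_def Q'_def \<nu>_def U_def
    by (intro mult_left_mono flux_action_midpoint(1) pos nonneg' that) simp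
  have "(\<integral>\<^sup>+t. F t \<partial>?M) = E_Quad K w a b (\<mu>, V, h) + E_Quad K w a b (\<mu>', V', h')"
    unfolding F_def E[OF CE(1)] E[OF CE(2)]
    by (rule nn_integral_add[OF dens_meas[OF CE(1)] dens_meas[OF CE(2)]])
  also have "\<dots> = 2 * W_squared K w p a b \<mu>0 \<mu>1" by (simp add: min mult_2)
  finally have intF: "(\<integral>\<^sup>+t. F t \<partial>?M) = 2 * W_squared K w p a b \<mu>0 \<mu>1" .
  have intG: "(\<integral>\<^sup>+t. G t \<partial>?M) = 2 * E_Quad K w a b (\<nu>, U, k)"
    unfolding G_def E[OF mid] by (rule nn_integral_cmult[OF dens_meas[OF mid]])
  have "0 < \<nu> t x" if "t \<in> {0..1}" for t x
    using pos[OF that, of x] nonneg'[OF that, of x] by (simp add: \<nu>_def add_pos_nonneg)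
  then have "W_squared K w p a b \<mu>0 \<mu>1 \<le> E_Quad K w a b (\<nu>, U, k)"
    by (rule W_squared_le_E_Quad[OF K w rev mid])
  then have FG: "(\<integral>\<^sup>+t. F t \<partial>?M) \<le> (\<integral>\<^sup>+t. G t \<partial>?M)"
    unfolding intF intG by (rule mult_left_mono) simp
  have F_fin: "(\<integral>\<^sup>+t. F t \<partial>?M) < \<infinity>"
    using W_squared_finite[OF K w rev p, of \<mu>0 \<mu>1 a b] ends
    unfolding intF by (simp add: ennreal_mult_less_top)
  have GF: "AE t in ?M. G t \<le> F t"
    unfolding G_PQ F_PQ using PP QQ by (intro AE_I2 add_mono) auto
  have "AE t in ?M. G t = F t"
    using nn_integral_mono_AE[OF GF] F_fin
    by (intro nn_integral_ge_imp_AE_eq[OF G_meas F_meas GF FG]) (rule le_less_trans)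
  moreover have "AE t in ?M. F t \<noteq> \<infinity>"
    using F_fin by (intro nn_integral_PInf_AE F_meas) simp
  moreover have "AE t in ?M. t \<in> {0..1}" by (rule AE_I2) simp
  ultimately show ?thesis
  proof eventually_elim
    case (elim t)
    have fin: "P t + Q t < \<infinity>" using elim(1,2) by (simp add: G_PQ less_top)
    have eq: "P t = P' t" "Q t = Q' t"
    proof -
      have ge: "P' t + Q' t \<le> P t + Q t" using elim(1) unfolding G_PQ F_PQ by simp
      show "P t = P' t" "Q t = Q' t"
        by (rule ennreal_add_le_imp_eq[OF PP QQ[OF elim(3)] ge fin])+
    qed
    have "ennreal (2 * (k t)\<^sup>2) = ennreal ((h t)\<^sup>2 + (h' t)\<^sup>2)"
      using eq(1) ab unfolding P_def P'_def by (subst (asm) ennreal_mult_cancel_left) auto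
    then have "2 * (k t)\<^sup>2 = (h t)\<^sup>2 + (h' t)\<^sup>2"
      by (subst (asm) ennreal_inj) auto
    then have "(h t - h' t)\<^sup>2 = 0" using h_mid[of t] by linarith
    then have hh: "h t = h' t" by simp
    have "2 * flux_action K w (\<nu> t) (U t) = flux_action K w (\<mu> t) (V t) + flux_action K w (\<mu>' t) (V' t)"
      using eq(2) ab unfolding Q_def Q'_def by (subst (asm) ennreal_mult_cancel_left) auto
    moreover have "2 * flux_action K w (\<nu> t) (U t) < \<infinity>"
    proof -
      have "Q t < \<infinity>" using fin by simp
      then show ?thesis using ab unfolding Q_def by (auto simp: ennreal_mult_less_top)
    qed
    ultimately have "V' t x y * \<mu> t x = \<mu>' t x * V t x y \<and> V' t x y * \<mu> t y = \<mu>' t y * V t x y"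
      if "0 < K x y" for x y
      using that invariant_prob_pos[OF K w] unfolding \<nu>_def U_def
      by (intro flux_action_midpoint(2)[where K = K and w = w and x = x and y = y, OF pos[OF elim(3)] nonneg'[OF elim(3)]]) auto
    with hh show ?case by blast
  qed
qed

text \<open>Gronwall's lemma is applied to \<open>q = \<mu>' / \<mu> - 1\<close>, which solves \<open>q' = - (h p / \<mu>) q\<close> with
  \<open>q(0) = 0\<close>. On the compact interval \<^term>\<open>\<mu>\<close> has a positive lower bound \<open>m\<close>; this gives
  absolute continuity of the quotient and bounds the coefficient by \<open>\<bar>p\<bar> / m * (1 + h\<^sup>2)\<close>,
  which is integrable as the action is finite.\<close>

lemma curves_eq_if_fluxes_parallel:
  fixes K :: "'x::finite \<Rightarrow> 'x \<Rightarrow> real"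
  assumes K0: "\<And>x y. 0 \<le> K x y" and rev: "reversible_wrt K w" and w: "\<And>x. 0 < w x"
    and CE: "(\<mu>, V, h) \<in> CE K p \<mu>0 \<mu>1" "(\<mu>', V', h') \<in> CE K p \<mu>0 \<mu>1"
    and pos: "\<And>t x. t \<in> {0..1} \<Longrightarrow> 0 < \<mu> t x"
    and h2: "(\<integral>\<^sup>+t. ennreal ((h t)\<^sup>2) \<partial>lebesgue_on {0..1}) < \<infinity>"
    and par: "AE t in lebesgue_on {0..1}. h t = h' t \<and> (\<forall>x y. 0 < K x y \<longrightarrow>
      V' t x y * \<mu> t x = \<mu>' t x * V t x y \<and> V' t x y * \<mu> t y = \<mu>' t y * V t x y)"
    and t: "t \<in> {0..1}"
  shows "\<mu> t x = \<mu>' t x"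
proof -
  have adm: "admissible_curve \<mu>0 \<mu>1 \<mu>" "admissible_curve \<mu>0 \<mu>1 \<mu>'" using CE by (auto simp: CE_def)
  have ac: "abs_continuous_on_Icc 0 1 (\<lambda>t. \<mu> t x)" "abs_continuous_on_Icc 0 1 (\<lambda>t. \<mu>' t x)"
    using adm by (auto simp: admissible_curve_def)
  note cont = ac[THEN abs_continuous_on_Icc_imp_continuous_on]
  obtain s where s: "s \<in> {0..1}" "\<And>t. t \<in> {0..1} \<Longrightarrow> \<mu> s x \<le> \<mu> t x"
    using continuous_attains_inf[OF _ _ cont(1)] by auto
  define m where "m = \<mu> s x"
  have m: "0 < m" "\<And>t. t \<in> {0..1} \<Longrightarrow> m \<le> \<mu> t x" using s pos by (auto simp: m_def)
  obtain s' where s': "s' \<in> {0..1}" "\<And>t. t \<in> {0..1} \<Longrightarrow> \<mu>' t x \<le> \<mu>' s' x"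
    using continuous_attains_sup[OF _ _ cont(2)] by auto
  define B where "B = \<mu>' s' x"
  have B: "0 \<le> \<mu>' t x" "\<mu>' t x \<le> B" if "t \<in> {0..1}" for t
    using s' that adm by (auto simp: B_def admissible_curve_def)
  define q where "q t = \<mu>' t x / \<mu> t x - 1" for t
  have q_ac: "abs_continuous_on_Icc 0 1 q"
  proof (rule abs_continuous_on_Icc_dominated[OF ac, of "1 / m + B / m\<^sup>2"])
    have "0 \<le> B" using B[of 0] by simp
    then show "0 \<le> 1 / m + B / m\<^sup>2" using m by simp
    fix s t :: real assume st: "s \<in> {0..1}" "t \<in> {0..1}"
    have ps: "m \<le> \<mu> s x" "m \<le> \<mu> t x" "0 < \<mu> s x" "0 < \<mu> t x" using m st pos by auto
    have "q t - q s = (\<mu>' t x - \<mu>' s x) / \<mu> t x + \<mu>' s x * (\<mu> s x - \<mu> t x) / (\<mu> s x * \<mu> t x)"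
      using ps by (simp add: q_def field_simps)
    then have "\<bar>q t - q s\<bar> \<le> \<bar>\<mu>' t x - \<mu>' s x\<bar> / \<mu> t x + \<mu>' s x * \<bar>\<mu> s x - \<mu> t x\<bar> / (\<mu> s x * \<mu> t x)"
      using abs_triangle_ineq[of "(\<mu>' t x - \<mu>' s x) / \<mu> t x" "\<mu>' s x * (\<mu> s x - \<mu> t x) / (\<mu> s x * \<mu> t x)"]
        ps B[OF st(1)] by (simp add: abs_mult)
    also have "\<dots> \<le> \<bar>\<mu>' t x - \<mu>' s x\<bar> / m + B * \<bar>\<mu> s x - \<mu> t x\<bar> / m\<^sup>2"
      using ps B[OF st(1)] m unfolding power2_eq_square
      by (intro add_mono frac_le mult_mono mult_nonneg_nonneg) auto
    also have "\<dots> \<le> (1 / m + B / m\<^sup>2) * (\<bar>\<mu> t x - \<mu> s x\<bar> + \<bar>\<mu>' t x - \<mu>' s x\<bar>)"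
    proof -
      have "(1 / m + B / m\<^sup>2) * (\<bar>\<mu> t x - \<mu> s x\<bar> + \<bar>\<mu>' t x - \<mu>' s x\<bar>)
        = \<bar>\<mu>' t x - \<mu>' s x\<bar> / m + B * \<bar>\<mu> s x - \<mu> t x\<bar> / m\<^sup>2
          + (\<bar>\<mu> t x - \<mu> s x\<bar> / m + B / m\<^sup>2 * \<bar>\<mu>' t x - \<mu>' s x\<bar>)"
        by (simp add: distrib_left distrib_right abs_minus_commute)
      moreover have "0 \<le> \<bar>\<mu> t x - \<mu> s x\<bar> / m + B / m\<^sup>2 * \<bar>\<mu>' t x - \<mu>' s x\<bar>"
        using m \<open>0 \<le> B\<close> by simp
      ultimately show ?thesis by linarith
    qed
    finally show "\<bar>q t - q s\<bar> \<le> (1 / m + B / m\<^sup>2) * (\<bar>\<mu> t x - \<mu> s x\<bar> + \<bar>\<mu>' t x - \<mu>' s x\<bar>)" .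
  qed
  define g where "g t = \<bar>p x\<bar> / m * (1 + (h t)\<^sup>2)" for t
  have "AE t in lebesgue_on {0..1}. \<exists>D. (q has_real_derivative D) (at t within {0..1}) \<and> \<bar>D\<bar> \<le> g t * \<bar>q t\<bar>"
  proof -
    have ae1: "AE t in lebesgue_on {0..1}. \<forall>x. \<exists>d. ((\<lambda>s. \<mu> s x) has_real_derivative d) (at t within {0..1}) \<and>
        d + divergence K (V t) x = h t * p x"
      and ae2: "AE t in lebesgue_on {0..1}. \<forall>x. \<exists>d. ((\<lambda>s. \<mu>' s x) has_real_derivative d) (at t within {0..1}) \<and>
        d + divergence K (V' t) x = h' t * p x"
      using CE by (auto simp: CE_def)
    have "AE t in lebesgue_on {0..1::real}. t \<in> {0..1}" by (rule AE_I2) simp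
    with ae1 ae2 par show ?thesis
    proof eventually_elim
      case (elim t)
      obtain d where d: "((\<lambda>s. \<mu> s x) has_real_derivative d) (at t within {0..1})"
        "d + divergence K (V t) x = h t * p x" using elim(1) by blast
      obtain e where e: "((\<lambda>s. \<mu>' s x) has_real_derivative e) (at t within {0..1})"
        "e + divergence K (V' t) x = h' t * p x" using elim(2) by blast
      have u: "0 < \<mu> t x" "m \<le> \<mu> t x" using pos[OF elim(4)] m(2)[OF elim(4)] by auto
      have edge: "\<mu> t x * (V' t x y * K x y) = \<mu>' t x * (V t x y * K x y)"
          "\<mu> t x * (V' t y x * K x y) = \<mu>' t x * (V t y x * K x y)" for y
      proof -
        show "\<mu> t x * (V' t x y * K x y) = \<mu>' t x * (V t x y * K x y)"
          using elim(3) K0[of x y] by (cases "K x y = 0") (auto simp: mult.commute)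
        \<comment> \<open>Reversibility makes the edge relation symmetric, so the reversed flux is proportional too, with
          the same factor at \<^term>\<open>x\<close>.\<close>
        have "0 < K y x" if "K x y \<noteq> 0"
        proof -
          have "0 < K x y * w x" using that K0[of x y] w[of x] by (simp add: zero_less_mult_iff)
          then have "0 < K y x * w y" using rev by (simp add: reversible_wrt_def)
          then show ?thesis using w[of y] by (rule zero_less_mult_pos2)
        qed
        then show "\<mu> t x * (V' t y x * K x y) = \<mu>' t x * (V t y x * K x y)"
          using elim(3) by (cases "K x y = 0") (auto simp: mult.commute)
      qed
      have "\<mu> t x * divergence K (V' t) x
          = 1/2 * (\<Sum>y\<in>UNIV. \<mu> t x * (V' t x y * K x y) - \<mu> t x * (V' t y x * K x y))"
        by (simp add: divergence_def sum_distrib_left algebra_simps)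
      also have "\<dots> = \<mu>' t x * divergence K (V t) x"
        unfolding edge by (simp add: divergence_def sum_distrib_left algebra_simps)
      finally have div: "\<mu> t x * divergence K (V' t) x = \<mu>' t x * divergence K (V t) x" .
      define D where "D = (e * \<mu> t x - \<mu>' t x * d) / (\<mu> t x * \<mu> t x)"
      have "(q has_real_derivative D) (at t within {0..1})"
        unfolding q_def D_def using u
        by (auto intro!: derivative_eq_intros d(1) e(1))
      moreover have D: "D = - (h t * p x / \<mu> t x) * q t"
      proof -
        have "e * \<mu> t x - \<mu>' t x * d = h t * p x * (\<mu> t x - \<mu>' t x)"
        proof -
          have e_eq: "e = h t * p x - divergence K (V' t) x" and d_eq: "d = h t * p x - divergence K (V t) x"
            using d(2) e(2) elim(3) by auto
          have "e * \<mu> t x - \<mu>' t x * d = h t * p x * (\<mu> t x - \<mu>' t x)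
              - (\<mu> t x * divergence K (V' t) x - \<mu>' t x * divergence K (V t) x)"
            unfolding e_eq d_eq by (simp add: algebra_simps)
          then show ?thesis by (simp add: div)
        qed
        then have "D = h t * p x * (\<mu> t x - \<mu>' t x) / (\<mu> t x * \<mu> t x)" by (simp add: D_def)
        also have "\<dots> = - (h t * p x / \<mu> t x) * q t" using u by (simp add: q_def divide_simps) (simp add: algebra_simps)
        finally show ?thesis .
      qed
      moreover have "\<bar>D\<bar> \<le> g t * \<bar>q t\<bar>"
      proof -
        \<comment> \<open>Only square integrability of \<^term>\<open>h\<close> is known, so its absolute value is traded for its square.\<close>
        have "\<bar>h t\<bar> \<le> 1 + (h t)\<^sup>2"
          using zero_le_power2[of "\<bar>h t\<bar> - 1"] by (simp add: power2_diff)
        then have "\<bar>p x\<bar> * \<bar>h t\<bar> / \<mu> t x \<le> \<bar>p x\<bar> * (1 + (h t)\<^sup>2) / m"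
          using u m by (intro frac_le mult_left_mono) auto
        then have "\<bar>h t * p x / \<mu> t x\<bar> \<le> g t" using u by (simp add: g_def abs_mult mult.commute)
        then show ?thesis unfolding D abs_mult abs_minus by (rule mult_right_mono) simp
      qed
      ultimately show ?case by blast
    qed
  qed
  then obtain N where N: "negligible N" and der: "\<And>t. t \<in> {0..1} - N \<Longrightarrow>
      \<exists>D. (q has_real_derivative D) (at t within {0..1}) \<and> \<bar>D\<bar> \<le> g t * \<bar>q t\<bar>"
  proof -
    assume "AE t in lebesgue_on {0..1}. \<exists>D. (q has_real_derivative D) (at t within {0..1}) \<and> \<bar>D\<bar> \<le> g t * \<bar>q t\<bar>"
    then have "AE t in lebesgue. t \<in> {0..1} \<longrightarrow> (\<exists>D. (q has_real_derivative D) (at t within {0..1}) \<and> \<bar>D\<bar> \<le> g t * \<bar>q t\<bar>)"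
      by (subst (asm) AE_restrict_space_iff) auto
    then obtain N where "N \<in> null_sets lebesgue"
      "{t \<in> space lebesgue. \<not> (t \<in> {0..1} \<longrightarrow> (\<exists>D. (q has_real_derivative D) (at t within {0..1}) \<and> \<bar>D\<bar> \<le> g t * \<bar>q t\<bar>))} \<subseteq> N"
      unfolding eventually_ae_filter by blast
    then show ?thesis by (intro that[of N]) (auto simp: negligible_iff_null_sets)
  qed
  have "integrable (lebesgue_on {0..1}) (\<lambda>t. (h t)\<^sup>2)"
    using h2 CE(1) by (intro integrableI_nonneg) (auto simp: CE_def)
  then have "(\<lambda>t. (h t)\<^sup>2) integrable_on {0..1}" by (rule integrable_on_lebesgue_on) simp
  then have g_int: "g integrable_on {0..1}"
    unfolding g_def[abs_def] by (intro integrable_on_mult_right integrable_add) auto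
  have "q 0 = 0"
    using adm pos[of 0 x] by (simp add: q_def admissible_curve_def)
  then have "q t = 0"
    by (rule abs_continuous_gronwall[OF q_ac N _ g_int _ der t]) (use m in \<open>auto simp: g_def\<close>)
  then show ?thesis using pos[OF t, of x] by (simp add: q_def field_simps)
qed

theorem proposition3p15:
  fixes K :: "'x::finite \<Rightarrow> 'x \<Rightarrow> real"
    and w p \<mu>0 \<mu>1 :: "'x \<Rightarrow> real"
    and a b :: real
    and \<mu> :: "nat \<Rightarrow> real \<Rightarrow> 'x \<Rightarrow> real"
    and V :: "nat \<Rightarrow> real \<Rightarrow> 'x \<Rightarrow> 'x \<Rightarrow> real"
    and h :: "nat \<Rightarrow> real \<Rightarrow> real"
  assumes "markov_kernel K" and "irreducible_kernel K"
    and "invariant_prob K w" and "reversible_wrt K w"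
    and "a > 0" and "b > 0"
    and "\<And>x. p x > 0" and "(\<Sum>x\<in>UNIV. p x * w x) = 1"
    and "\<And>x. \<mu>0 x > 0" and "\<And>x. \<mu>1 x > 0"
    and "\<And>i. i \<in> {1, 2} \<Longrightarrow> (\<mu> i, V i, h i) \<in> CE K p \<mu>0 \<mu>1"
    and "\<And>i. i \<in> {1, 2} \<Longrightarrow> E_Quad K w a b (\<mu> i, V i, h i) = W_squared K w p a b \<mu>0 \<mu>1"
    and "\<And>i. i \<in> {1, 2} \<Longrightarrow> AE t in lebesgue_on {0..1}. \<forall>x y. V i t x y = - V i t y x"
    and "\<And>i. i \<in> {1, 2} \<Longrightarrow>
           AE t in lebesgue_on {0..1}. \<forall>x y. K x y = 0 \<longrightarrow> V i t x y = 0"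
    and "\<And>t x. t \<in> {0..1} \<Longrightarrow> \<mu> 1 t x > 0"
  shows "(\<forall>t\<in>{0..1}. \<mu> 1 t = \<mu> 2 t) \<and>
         (AE t in lebesgue_on {0..1}. V 1 t = V 2 t \<and> h 1 t = h 2 t)"
proof -
  note K = assms(1,2) and w = assms(3) and rev = assms(4) and p = assms(8) and ends = assms(9,10)
  have CE: "(\<mu> 1, V 1, h 1) \<in> CE K p \<mu>0 \<mu>1" "(\<mu> 2, V 2, h 2) \<in> CE K p \<mu>0 \<mu>1"
    using assms(11) by simp_all
  have min: "E_Quad K w a b (\<mu> 1, V 1, h 1) = W_squared K w p a b \<mu>0 \<mu>1"
    "E_Quad K w a b (\<mu> 2, V 2, h 2) = W_squared K w p a b \<mu>0 \<mu>1"
    using assms(12) by simp_all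
  have K0: "0 \<le> K x y" for x y using K by (simp add: markov_kernel_def)
  have par: "AE t in lebesgue_on {0..1}. h 1 t = h 2 t \<and> (\<forall>x y. 0 < K x y \<longrightarrow>
      V 2 t x y * \<mu> 1 t x = \<mu> 2 t x * V 1 t x y \<and> V 2 t x y * \<mu> 1 t y = \<mu> 2 t y * V 1 t x y)"
    by (rule minimizers_parallel[OF K w rev assms(5,6) p ends CE min assms(15)])
  have "E_Quad K w a b (\<mu> 1, V 1, h 1) < \<infinity>"
    unfolding min by (rule W_squared_finite[OF K w rev p ends])
  then have h2: "(\<integral>\<^sup>+t. ennreal ((h 1 t)\<^sup>2) \<partial>lebesgue_on {0..1}) < \<infinity>"
    using \<open>a > 0\<close> by (auto simp: E_Quad_def ennreal_mult_less_top)
  have eq: "\<mu> 1 t x = \<mu> 2 t x" if "t \<in> {0..1}" for t x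
    by (rule curves_eq_if_fluxes_parallel[OF K0 rev invariant_prob_pos[OF K w] CE assms(15) h2 par that])
  have "AE t in lebesgue_on {0..1::real}. t \<in> {0..1}" by (rule AE_I2) simp
  moreover have "AE t in lebesgue_on {0..1}. \<forall>x y. K x y = 0 \<longrightarrow> V 1 t x y = 0"
    "AE t in lebesgue_on {0..1}. \<forall>x y. K x y = 0 \<longrightarrow> V 2 t x y = 0"
    using assms(14) by simp_all
  ultimately have "AE t in lebesgue_on {0..1}. V 1 t = V 2 t \<and> h 1 t = h 2 t"
    using par
  proof eventually_elim
    case (elim t)
    have "V 1 t x y = V 2 t x y" for x y
    proof (cases "K x y = 0")
      case False
      then have "V 2 t x y * \<mu> 1 t x = \<mu> 2 t x * V 1 t x y"
        using elim(4) K0[of x y] by simp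
      then show ?thesis using eq[OF elim(1), of x] assms(15)[OF elim(1), of x] by simp
    qed (use elim in simp)
    then show ?case using elim(4) by (simp add: fun_eq_iff)
  qed
  then show ?thesis using eq by (auto simp: fun_eq_iff)
qed

end
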